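(* For any $k$ the quasi-Hamiltonian $T$-space $\mathcal{B}=\mathcal{B}^k$ is isomorphic to the open subset $(s_2,s_3,\ldots,s_{2k-1})\neq0$ of $\mathbb{C}^{2k-2}$ (with coordinates $s_2,s_3,\ldots,s_{2k-1}$), the continuant $(s_2,s_3,\ldots,s_{2k-1})$ is a group-valued moment map for the $\mathbb{C}^*$ action on this subset, and, for $q\in\mathbb{C}^*$ and $t=\mathrm{diag}(q^{-1},q)$, the wild character variety $\mathcal{M}_{\mathrm{B}}(t)$ is the quotient of the Eulerian hypersurface $$(s_2,s_3,\ldots,s_{2k-1})=1/q$$ by the action of $\mathbb{C}^*$.
   Context: Continuants: Euler's continuant polynomials are defined by $()=1$, $(x_1)=x_1$ and $(x_1,x_2,\ldots,x_n)=x_1(x_2,x_3,\ldots,x_n)+(x_3,x_4,\ldots,x_n)$; so $(a,b)=ab+1$, $(a,b,c)=abc+c+a$, etc. Here $(s_2,\ldots,s_{2k-1})$ denotes the continuant polynomial in these variables. The space $\mathcal{B}^k$ ($k\ge1$): let $U_+$ (resp. $U_-$) be the group of upper (resp. lower) triangular unipotent matrices in $G=\mathrm{GL}_2(\mathbb{C})$ and $T$ the diagonal subgroup. Then $$\mathcal{B}^k=\{(\mathbf{S},h)\in(U_+\times U_-)^k\times T : hS_{2k}\cdots S_2S_1=1\},$$ where $\mathbf{S}=(S_1,\ldots,S_{2k})$, $S_{\text{odd}}\in U_+$, $S_{\text{even}}\in U_-$, and $s_i$ denotes the off-diagonal entry of $S_i$ that is not forced to vanish. $T$ acts by conjugating each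 $S_i$ and fixing $h$. The $T$-action factors through the quotient of $T$ by scalar matrices, identified with $\mathbb{C}^*$ by $\mathrm{diag}(t_1,t_2)\mapsto c=t_1/t_2$; it acts by $s_i\mapsto cs_i$ for $i$ odd and $s_i\mapsto c^{-1}s_i$ for $i$ even. The quasi-Hamiltonian $T$-space structure on $\mathcal{B}^k$ has moment map $h^{-1}=S_{2k}\cdots S_1\in T$ and is obtained by quasi-Hamiltonian reduction: $\mathcal{B}^k=\mu_G^{-1}(1)/G$, where $\mathcal{A}=G\times(U_+\times U_-)^k\times T\ni(C,\mathbf{S},h)$ is the quasi-Hamiltonian $G\times T$-space with action $(g,t)(C,\mathbf{S},h)=(tCg^{-1},t\mathbf{S}t^{-1},h)$, moment map $(\mu_G,\mu_T)=(C^{-1}hS_{2k}\cdots S_1C,\ h^{-1})$ and two-form $$2\omega=(\bar\gamma,\mathrm{Ad}_b\bar\gamma)+(\bar\gamma,\bar\beta)+(\bar\gamma_{2k},\eta)-\sum_{i=1}^{2k}(\gamma_i,\gamma_{i-1}).$$ Here $(\ ,\ )$ is a fixed nondegenerate invariant symmetric bilinear form on $\mathrm{Lie}(G)$, $C_i=S_i\cdots S_1C$, $b=hS_{2k}\cdots S_1$, $\theta=g^{-1}dg$, $\bar\theta=dg\,g^{-1}$, $\gamma_i=C_i^*\theta$, $\bar\gamma_i=C_i^*\bar\theta$, $\bar\gamma=\bar\gamma_0$, $\eta=h^*\theta_T$ (with $\theta_T$ the Maurer--Cartan form of $T$), $\bar\beta=b^*\bar\theta$. Since $T$ is abelian, the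 resulting two-form on $\mathcal{B}^k$ is symplectic. An invariant function $f$ with values in $\mathbb{C}^*$ is a group-valued moment map for the $\mathbb{C}^*$ action on a symplectic variety if the contraction of the symplectic form with the vector field generating the action is $f^*$ of the Maurer--Cartan form $dx/x$, up to the nonzero constant determined by the normalisation of the bilinear form and sign conventions. Wild character variety: for $t\in T$ of determinant one, $\mathcal{M}_{\mathrm{B}}(t)=\{\mathbf{S}\in(U_+\times U_-)^k : S_{2k}\cdots S_2S_1=t\}/T$, the quotient by diagonal conjugation. Quotients are affine geometric invariant theory quotients (the affine variety associated to the ring of invariant functions). *)

theory Defs
  imports "HOL-Analysis.Analysis"
begin

type_synonym mat2 = "complex^2^2"

fun continuant :: "'a::comm_semiring_1 list \<Rightarrow> 'a" where
  "continuant [] = 1"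
| "continuant [x] = x"
| "continuant (x # y # zs) = x * continuant (y # zs) + continuant zs"

definition U_plus :: "mat2 set" where
  "U_plus = {g. g$1$1 = 1 \<and> g$2$2 = 1 \<and> g$2$1 = 0}"

definition U_minus :: "mat2 set" where
  "U_minus = {g. g$1$1 = 1 \<and> g$2$2 = 1 \<and> g$1$2 = 0}"

definition torus :: "mat2 set" where
  "torus = {g. g$1$2 = 0 \<and> g$2$1 = 0 \<and> g$1$1 \<noteq> 0 \<and> g$2$2 \<noteq> 0}"

definition diag2 :: "complex \<Rightarrow> complex \<Rightarrow> mat2" where
  "diag2 a d = vector [vector [a, 0], vector [0, d]]"

text \<open>A tuple \<open>(S_1, \<dots>, S_2k)\<close> is a function on \<open>nat\<close>; the irrelevant values outside
  \<open>{1..2k}\<close> are set to \<open>0\<close>, so that a tuple is determined by its \<open>2k\<close> components and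
  tangent vectors form a linear space. The same convention is used for coordinate vectors.\<close>

definition stokes :: "nat \<Rightarrow> (nat \<Rightarrow> mat2) set" where
  "stokes k = {S. (\<forall>i\<in>{1..2*k}. S i \<in> (if odd i then U_plus else U_minus)) \<and>
                  (\<forall>i. i \<notin> {1..2*k} \<longrightarrow> S i = 0)}"

primrec stokes_prod :: "(nat \<Rightarrow> mat2) \<Rightarrow> nat \<Rightarrow> mat2" where
  "stokes_prod S 0 = mat 1"
| "stokes_prod S (Suc n) = S (Suc n) ** stokes_prod S n"

type_synonym bpoint = "(nat \<Rightarrow> mat2) \<times> mat2"

definition Bspace :: "nat \<Rightarrow> bpoint set" where
  "Bspace k = {(S, h). S \<in> stokes k \<and> h \<in> torus \<and> h ** stokes_prod S (2*k) = mat 1}"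

definition torus_conj :: "mat2 \<Rightarrow> (nat \<Rightarrow> mat2) \<Rightarrow> (nat \<Rightarrow> mat2)" where
  "torus_conj t S = (\<lambda>i. t ** S i ** matrix_inv t)"

definition torus_act :: "mat2 \<Rightarrow> bpoint \<Rightarrow> bpoint" where
  "torus_act t = (\<lambda>(S, h). (torus_conj t S, h))"

definition moment_B :: "bpoint \<Rightarrow> mat2" where
  "moment_B = (\<lambda>(S, h). matrix_inv h)"

definition smat :: "complex \<Rightarrow> mat2 \<Rightarrow> mat2" where
  "smat c X = (\<chi> i j. c * X$i$j)"

definition invariant_form :: "(mat2 \<Rightarrow> mat2 \<Rightarrow> complex) \<Rightarrow> bool" where
  "invariant_form \<beta> \<longleftrightarrow>
     (\<forall>X Y Z. \<beta> (X + Y) Z = \<beta> X Z + \<beta> Y Z) \<and>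
     (\<forall>c X Y. \<beta> (smat c X) Y = c * \<beta> X Y) \<and>
     (\<forall>X Y. \<beta> X Y = \<beta> Y X) \<and>
     (\<forall>g X Y. invertible g \<longrightarrow>
        \<beta> (g ** X ** matrix_inv g) (g ** Y ** matrix_inv g) = \<beta> X Y) \<and>
     (\<forall>X. (\<forall>Y. \<beta> X Y = 0) \<longrightarrow> X = 0)"

type_synonym apoint = "mat2 \<times> (nat \<Rightarrow> mat2) \<times> mat2"

definition Aspace :: "nat \<Rightarrow> apoint set" where
  "Aspace k = {(C, S, h). invertible C \<and> S \<in> stokes k \<and> h \<in> torus}"

text \<open>\<open>Aspace k\<close> is open in an affine space, whose space of translations is its tangent space
  at every point; differentials are therefore derivatives along affine lines.\<close>

definition stokes_tangent :: "nat \<Rightarrow> (nat \<Rightarrow> mat2) set" where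
  "stokes_tangent k =
     {V. (\<forall>i\<in>{1..2*k}. V i $1$1 = 0 \<and> V i $2$2 = 0 \<and>
                        (if odd i then V i $2$1 = 0 else V i $1$2 = 0)) \<and>
         (\<forall>i. i \<notin> {1..2*k} \<longrightarrow> V i = 0)}"

definition A_tangent :: "nat \<Rightarrow> apoint set" where
  "A_tangent k = {(X, V, Y). V \<in> stokes_tangent k \<and> Y$1$2 = 0 \<and> Y$2$1 = 0}"

definition A_line :: "apoint \<Rightarrow> apoint \<Rightarrow> complex \<Rightarrow> apoint" where
  "A_line = (\<lambda>(C, S, h) (X, V, Y) z. (C + smat z X, (\<lambda>i. S i + smat z (V i)), h + smat z Y))"

definition A_diff :: "(apoint \<Rightarrow> mat2) \<Rightarrow> apoint \<Rightarrow> apoint \<Rightarrow> mat2" where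
  "A_diff F p v = (\<chi> i j. deriv (\<lambda>z. F (A_line p v z) $ i $ j) 0)"

definition mc_left :: "(apoint \<Rightarrow> mat2) \<Rightarrow> apoint \<Rightarrow> apoint \<Rightarrow> mat2" where
  "mc_left F p v = matrix_inv (F p) ** A_diff F p v"

definition mc_right :: "(apoint \<Rightarrow> mat2) \<Rightarrow> apoint \<Rightarrow> apoint \<Rightarrow> mat2" where
  "mc_right F p v = A_diff F p v ** matrix_inv (F p)"

text \<open>The two-form obtained from two matrix-valued one-forms by wedging and pairing,
  with the convention \<open>(a \<and> b)(v, w) = a(v) b(w) - a(w) b(v)\<close>.\<close>

definition wedge_pair ::
  "(mat2 \<Rightarrow> mat2 \<Rightarrow> complex) \<Rightarrow> ('v \<Rightarrow> mat2) \<Rightarrow> ('v \<Rightarrow> mat2) \<Rightarrow> 'v \<Rightarrow> 'v \<Rightarrow> complex" where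
  "wedge_pair \<beta> a b v w = \<beta> (a v) (b w) - \<beta> (a w) (b v)"

definition C_map :: "nat \<Rightarrow> apoint \<Rightarrow> mat2" where
  "C_map i = (\<lambda>(C, S, h). stokes_prod S i ** C)"

definition b_map :: "nat \<Rightarrow> apoint \<Rightarrow> mat2" where
  "b_map k = (\<lambda>(C, S, h). h ** stokes_prod S (2*k))"

definition h_map :: "apoint \<Rightarrow> mat2" where
  "h_map = (\<lambda>(C, S, h). h)"

definition moment_G :: "nat \<Rightarrow> apoint \<Rightarrow> mat2" where
  "moment_G k = (\<lambda>(C, S, h). matrix_inv C ** h ** stokes_prod S (2*k) ** C)"

definition omega_A ::
  "nat \<Rightarrow> (mat2 \<Rightarrow> mat2 \<Rightarrow> complex) \<Rightarrow> apoint \<Rightarrow> apoint \<Rightarrow> apoint \<Rightarrow> complex" where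
  "omega_A k \<beta> p v w = (1/2) *
     (wedge_pair \<beta> (mc_right (C_map 0) p)
        (\<lambda>u. b_map k p ** mc_right (C_map 0) p u ** matrix_inv (b_map k p)) v w
      + wedge_pair \<beta> (mc_right (C_map 0) p) (mc_right (b_map k) p) v w
      + wedge_pair \<beta> (mc_right (C_map (2*k)) p) (mc_left h_map p) v w
      - (\<Sum>i = 1..2*k. wedge_pair \<beta> (mc_left (C_map i) p) (mc_left (C_map (i - 1)) p) v w))"

text \<open>\<open>GL_2\<close> acts on \<open>A\<close> by \<open>(C, S, h) \<mapsto> (C g^{-1}, S, h)\<close>, so the quotient map from
  the fibre of \<open>moment_G\<close> over \<open>1\<close> to \<open>Bspace k\<close> is \<open>(C, S, h) \<mapsto> (S, h)\<close>, that is
  \<open>snd\<close>; being linear it is also its own differential. The reduced form is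
  the form on the quotient whose pullback to the fibre is the restriction of \<open>omega_A\<close>.\<close>

definition level_set :: "nat \<Rightarrow> apoint set" where
  "level_set k = {p \<in> Aspace k. moment_G k p = mat 1}"

definition level_tangent :: "nat \<Rightarrow> apoint \<Rightarrow> apoint set" where
  "level_tangent k p = {v \<in> A_tangent k. A_diff (moment_G k) p v = 0}"

definition is_reduced_form ::
  "nat \<Rightarrow> (mat2 \<Rightarrow> mat2 \<Rightarrow> complex) \<Rightarrow> (bpoint \<Rightarrow> bpoint \<Rightarrow> bpoint \<Rightarrow> complex) \<Rightarrow> bool" where
  "is_reduced_form k \<beta> \<omega> \<longleftrightarrow>
     (\<forall>p\<in>level_set k. \<forall>v\<in>level_tangent k p. \<forall>w\<in>level_tangent k p.
        \<omega> (snd p) (snd v) (snd w) = omega_A k \<beta> p v w)"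

definition B_tangent :: "nat \<Rightarrow> bpoint \<Rightarrow> bpoint set" where
  "B_tangent k p =
     {(V, Y). V \<in> stokes_tangent k \<and> Y$1$2 = 0 \<and> Y$2$1 = 0 \<and>
        (\<chi> i j. deriv (\<lambda>z. ((snd p + smat z Y) **
            stokes_prod (\<lambda>l. fst p l + smat z (V l)) (2*k)) $ i $ j) 0) = (0::mat2)}"

text \<open>A variety is given by its points together with its regular functions; functions are
  taken to vanish outside the point set, so that they are determined by their restriction
  to it.\<close>

type_synonym 'p variety = "'p set \<times> ('p \<Rightarrow> complex) set"

inductive_set polynomial_functions :: "('p \<Rightarrow> complex) set \<Rightarrow> ('p \<Rightarrow> complex) set"
  for coords :: "('p \<Rightarrow> complex) set" where
  const: "(\<lambda>_. c) \<in> polynomial_functions coords"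
| coord: "x \<in> coords \<Longrightarrow> x \<in> polynomial_functions coords"
| add: "\<lbrakk>f \<in> polynomial_functions coords; g \<in> polynomial_functions coords\<rbrakk>
     \<Longrightarrow> (\<lambda>p. f p + g p) \<in> polynomial_functions coords"
| mult: "\<lbrakk>f \<in> polynomial_functions coords; g \<in> polynomial_functions coords\<rbrakk>
     \<Longrightarrow> (\<lambda>p. f p * g p) \<in> polynomial_functions coords"

text \<open>Regular functions on a locally closed subset of affine space are those which are
  Zariski-locally quotients of polynomials.\<close>

definition regular_functions ::
  "('p \<Rightarrow> complex) set \<Rightarrow> 'p set \<Rightarrow> ('p \<Rightarrow> complex) set" where
  "regular_functions coords X =
     {f. (\<forall>x. x \<notin> X \<longrightarrow> f x = 0) \<and>
         (\<forall>p\<in>X. \<exists>g\<in>polynomial_functions coords. \<exists>d\<in>polynomial_functions coords.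
            d p \<noteq> 0 \<and> (\<forall>x\<in>X. d x \<noteq> 0 \<longrightarrow> f x = g x / d x))}"

definition subvariety :: "('p \<Rightarrow> complex) set \<Rightarrow> 'p set \<Rightarrow> 'p variety" where
  "subvariety coords X = (X, regular_functions coords X)"

definition pull_back :: "'p set \<Rightarrow> ('p \<Rightarrow> 'r) \<Rightarrow> ('r \<Rightarrow> complex) \<Rightarrow> ('p \<Rightarrow> complex)" where
  "pull_back X \<phi> f = (\<lambda>x. if x \<in> X then f (\<phi> x) else 0)"

definition variety_iso :: "('p \<Rightarrow> 'r) \<Rightarrow> 'p variety \<Rightarrow> 'r variety \<Rightarrow> bool" where
  "variety_iso \<phi> X Y \<longleftrightarrow>
     bij_betw \<phi> (fst X) (fst Y) \<and> pull_back (fst X) \<phi> ` snd Y = snd X"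

text \<open>The affine quotient has the ring of invariant functions as coordinate ring; its points
  are the unital \<open>\<complex>\<close>-algebra homomorphisms from that ring to \<open>\<complex>\<close> (extended by \<open>0\<close>).\<close>

definition invariant_ring :: "'g set \<Rightarrow> ('g \<Rightarrow> 'p \<Rightarrow> 'p) \<Rightarrow> 'p variety \<Rightarrow> ('p \<Rightarrow> complex) set" where
  "invariant_ring \<Gamma> act X = {f \<in> snd X. \<forall>g\<in>\<Gamma>. \<forall>x\<in>fst X. f (act g x) = f x}"

definition algebra_points :: "'p set \<Rightarrow> ('p \<Rightarrow> complex) set \<Rightarrow> (('p \<Rightarrow> complex) \<Rightarrow> complex) set" where
  "algebra_points X R =
     {ev. (\<forall>f. f \<notin> R \<longrightarrow> ev f = 0) \<and>
         (\<forall>c. ev (\<lambda>x. if x \<in> X then c else 0) = c) \<and>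
         (\<forall>f\<in>R. \<forall>g\<in>R. ev (\<lambda>x. f x + g x) = ev f + ev g \<and> ev (\<lambda>x. f x * g x) = ev f * ev g)}"

definition affine_quotient ::
  "'g set \<Rightarrow> ('g \<Rightarrow> 'p \<Rightarrow> 'p) \<Rightarrow> 'p variety \<Rightarrow> (('p \<Rightarrow> complex) \<Rightarrow> complex) variety" where
  "affine_quotient \<Gamma> act X =
     (let R = invariant_ring \<Gamma> act X; P = algebra_points (fst X) R
      in (P, {F. \<exists>f\<in>R. F = (\<lambda>ev. if ev \<in> P then ev f else 0)}))"

text \<open>The map of affine quotients induced by a map \<open>\<phi>\<close> from \<open>X\<close> to a variety whose ring
  of invariant functions is \<open>R\<close>.\<close>

definition quotient_map ::
  "'p set \<Rightarrow> ('r \<Rightarrow> complex) set \<Rightarrow> ('p \<Rightarrow> 'r)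
     \<Rightarrow> (('p \<Rightarrow> complex) \<Rightarrow> complex) \<Rightarrow> (('r \<Rightarrow> complex) \<Rightarrow> complex)" where
  "quotient_map X R \<phi> ev = (\<lambda>f. if f \<in> R then ev (pull_back X \<phi> f) else 0)"

definition stokes_coords :: "nat \<Rightarrow> ((nat \<Rightarrow> mat2) \<Rightarrow> complex) set" where
  "stokes_coords k = {x. \<exists>i\<in>{1..2*k}. \<exists>a b. x = (\<lambda>S. S i $ a $ b)}"

definition B_coords :: "nat \<Rightarrow> (bpoint \<Rightarrow> complex) set" where
  "B_coords k = {x. \<exists>f\<in>stokes_coords k. x = (\<lambda>(S, h). f S)} \<union>
                {x. \<exists>a b. x = (\<lambda>(S, h). h $ a $ b)}"

definition B_variety :: "nat \<Rightarrow> bpoint variety" where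
  "B_variety k = subvariety (B_coords k) (Bspace k)"

text \<open>Affine space of dimension \<open>2k - 2\<close>, coordinates indexed by \<open>2, \<dots>, 2k - 1\<close>.\<close>

definition coord_space :: "nat \<Rightarrow> (nat \<Rightarrow> complex) set" where
  "coord_space k = {x. \<forall>i. i \<notin> {2..<2*k} \<longrightarrow> x i = 0}"

definition coord_functions :: "nat \<Rightarrow> ((nat \<Rightarrow> complex) \<Rightarrow> complex) set" where
  "coord_functions k = {f. \<exists>i\<in>{2..<2*k}. f = (\<lambda>x. x i)}"

definition euler :: "nat \<Rightarrow> (nat \<Rightarrow> complex) \<Rightarrow> complex" where
  "euler k x = continuant (map x [2..<2*k])"

definition euler_open :: "nat \<Rightarrow> (nat \<Rightarrow> complex) set" where
  "euler_open k = {x \<in> coord_space k. euler k x \<noteq> 0}"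

definition euler_open_variety :: "nat \<Rightarrow> (nat \<Rightarrow> complex) variety" where
  "euler_open_variety k = subvariety (coord_functions k) (euler_open k)"

definition scale_act :: "complex \<Rightarrow> (nat \<Rightarrow> complex) \<Rightarrow> (nat \<Rightarrow> complex)" where
  "scale_act c x = (\<lambda>i. if odd i then c * x i else inverse c * x i)"

definition torus_char :: "mat2 \<Rightarrow> complex" where
  "torus_char t = t$1$1 / t$2$2"

definition stokes_param :: "nat \<Rightarrow> (nat \<Rightarrow> mat2) \<Rightarrow> (nat \<Rightarrow> complex)" where
  "stokes_param k S =
     (\<lambda>i. if i \<in> {2..<2*k} then (if odd i then S i $1$2 else S i $2$1) else 0)"

definition B_param :: "nat \<Rightarrow> bpoint \<Rightarrow> (nat \<Rightarrow> complex)" where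
  "B_param k = (\<lambda>(S, h). stokes_param k S)"

definition dir_deriv ::
  "((nat \<Rightarrow> complex) \<Rightarrow> complex) \<Rightarrow> (nat \<Rightarrow> complex) \<Rightarrow> (nat \<Rightarrow> complex) \<Rightarrow> complex" where
  "dir_deriv f x v = deriv (\<lambda>z. f (\<lambda>i. x i + z * v i)) 0"

type_synonym cform =
  "(nat \<Rightarrow> complex) \<Rightarrow> (nat \<Rightarrow> complex) \<Rightarrow> (nat \<Rightarrow> complex) \<Rightarrow> complex"

text \<open>Algebraic symplectic forms on a Zariski open subset \<open>U\<close> of \<open>coord_space k\<close>. Closedness
  is expressed on constant vector fields, whose Lie brackets vanish.\<close>

definition symplectic_form :: "nat \<Rightarrow> (nat \<Rightarrow> complex) set \<Rightarrow> cform \<Rightarrow> bool" where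
  "symplectic_form k U \<omega> \<longleftrightarrow>
     (\<forall>x\<in>U. \<forall>u\<in>coord_space k. \<forall>v\<in>coord_space k. \<forall>w\<in>coord_space k.
        \<omega> x (\<lambda>i. u i + v i) w = \<omega> x u w + \<omega> x v w) \<and>
     (\<forall>x\<in>U. \<forall>c. \<forall>v\<in>coord_space k. \<forall>w\<in>coord_space k. \<omega> x (\<lambda>i. c * v i) w = c * \<omega> x v w) \<and>
     (\<forall>x\<in>U. \<forall>v\<in>coord_space k. \<forall>w\<in>coord_space k. \<omega> x v w = - \<omega> x w v) \<and>
     (\<forall>v\<in>coord_space k. \<forall>w\<in>coord_space k.
        (\<lambda>x. if x \<in> U then \<omega> x v w else 0) \<in> regular_functions (coord_functions k) U) \<and>
     (\<forall>x\<in>U. \<forall>u\<in>coord_space k. \<forall>v\<in>coord_space k. \<forall>w\<in>coord_space k.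
        dir_deriv (\<lambda>y. \<omega> y v w) x u + dir_deriv (\<lambda>y. \<omega> y w u) x v
          + dir_deriv (\<lambda>y. \<omega> y u v) x w = 0) \<and>
     (\<forall>x\<in>U. \<forall>v\<in>coord_space k. (\<forall>w\<in>coord_space k. \<omega> x v w = 0) \<longrightarrow> v = (\<lambda>_. 0))"

definition generating_field ::
  "(complex \<Rightarrow> (nat \<Rightarrow> complex) \<Rightarrow> (nat \<Rightarrow> complex)) \<Rightarrow> (nat \<Rightarrow> complex) \<Rightarrow> (nat \<Rightarrow> complex)" where
  "generating_field act x = (\<lambda>i. deriv (\<lambda>c. act c x i) 1)"

text \<open>\<open>\<kappa>\<close> is the normalisation constant: the contraction of the form with the generating
  vector field is \<open>\<kappa>\<close> times the pullback under \<open>f\<close> of \<open>dx/x\<close>.\<close>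

definition group_valued_moment_map ::
  "nat \<Rightarrow> (nat \<Rightarrow> complex) set \<Rightarrow> (complex \<Rightarrow> (nat \<Rightarrow> complex) \<Rightarrow> (nat \<Rightarrow> complex))
     \<Rightarrow> cform \<Rightarrow> complex \<Rightarrow> ((nat \<Rightarrow> complex) \<Rightarrow> complex) \<Rightarrow> bool" where
  "group_valued_moment_map k U act \<omega> \<kappa> f \<longleftrightarrow>
     symplectic_form k U \<omega> \<and>
     (\<forall>c x. c \<noteq> 0 \<and> x \<in> U \<longrightarrow> act c x \<in> U \<and> f (act c x) = f x) \<and>
     (\<forall>x\<in>U. f x \<noteq> 0) \<and>
     (\<forall>x\<in>U. \<forall>w\<in>coord_space k. \<omega> x (generating_field act x) w = \<kappa> * (dir_deriv f x w / f x))"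

text \<open>The torus acts on \<open>euler_open k\<close> through \<open>torus_char\<close>, with torus-valued moment map
  \<open>x \<mapsto> diag2 (euler k x) (inverse (euler k x))\<close>. As the restriction of a linear map,
  \<open>B_param k\<close> is its own differential on tangent vectors.\<close>

definition quasi_hamiltonian_iso ::
  "nat \<Rightarrow> (bpoint \<Rightarrow> bpoint \<Rightarrow> bpoint \<Rightarrow> complex) \<Rightarrow> cform \<Rightarrow> bool" where
  "quasi_hamiltonian_iso k \<omega>B \<omega>U \<longleftrightarrow>
     variety_iso (B_param k) (B_variety k) (euler_open_variety k) \<and>
     (\<forall>t\<in>torus. \<forall>p\<in>Bspace k.
        torus_act t p \<in> Bspace k \<and>
        B_param k (torus_act t p) = scale_act (torus_char t) (B_param k p)) \<and>
     (\<forall>p\<in>Bspace k. moment_B p = diag2 (euler k (B_param k p)) (inverse (euler k (B_param k p)))) \<and>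
     (\<forall>p\<in>Bspace k. \<forall>v\<in>B_tangent k p. \<forall>w\<in>B_tangent k p.
        \<omega>U (B_param k p) (B_param k v) (B_param k w) = \<omega>B p v w)"

definition stokes_fibre :: "nat \<Rightarrow> mat2 \<Rightarrow> (nat \<Rightarrow> mat2) variety" where
  "stokes_fibre k t = subvariety (stokes_coords k) {S \<in> stokes k. stokes_prod S (2*k) = t}"

definition wild_character_variety ::
  "nat \<Rightarrow> mat2 \<Rightarrow> (((nat \<Rightarrow> mat2) \<Rightarrow> complex) \<Rightarrow> complex) variety" where
  "wild_character_variety k t = affine_quotient torus torus_conj (stokes_fibre k t)"

definition euler_hypersurface :: "nat \<Rightarrow> complex \<Rightarrow> (nat \<Rightarrow> complex) variety" where
  "euler_hypersurface k c = subvariety (coord_functions k) {x \<in> coord_space k. euler k x = c}"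

definition euler_quotient :: "nat \<Rightarrow> complex \<Rightarrow> (((nat \<Rightarrow> complex) \<Rightarrow> complex) \<Rightarrow> complex) variety" where
  "euler_quotient k c = affine_quotient (- {0}) scale_act (euler_hypersurface k c)"

definition fibre_quotient_map ::
  "nat \<Rightarrow> complex \<Rightarrow> (((nat \<Rightarrow> mat2) \<Rightarrow> complex) \<Rightarrow> complex)
     \<Rightarrow> (((nat \<Rightarrow> complex) \<Rightarrow> complex) \<Rightarrow> complex)" where
  "fibre_quotient_map k q =
     quotient_map (fst (stokes_fibre k (diag2 (inverse q) q)))
       (invariant_ring (- {0}) scale_act (euler_hypersurface k (1 / q)))
       (stokes_param k)"

end

theory Submission
  imports Defs
begin

text \<open>
  Write \<open>e\<^sub>n\<close> and \<open>g\<^sub>n\<close> (\<open>numer s n\<close> and \<open>denom s n\<close> below) for the solutions of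
  \<open>u (n + 2) = s (n + 1) u (n + 1) + u n\<close> with initial values \<open>1, 0\<close> and \<open>0, 1\<close>. Multiplying by
  one more Stokes factor is one step of this recurrence, so the partial product
  \<open>P\<^sub>n = S\<^sub>n \<cdots> S\<^sub>1\<close> has the entries \<open>e\<^sub>n, g\<^sub>n, e\<^sub>n\<^sub>+\<^sub>1, g\<^sub>n\<^sub>+\<^sub>1\<close>, its two rows changing places with the
  parity of \<open>n\<close>. Since \<open>e\<^sub>1 = 0\<close>, the entry \<open>e\<^sub>2\<^sub>k\<close> does not involve \<open>s\<^sub>1\<close>; it is the continuant
  \<open>K = (s\<^sub>2, \<dots>, s\<^sub>2\<^sub>k\<^sub>-\<^sub>1)\<close>. The product \<open>P\<^sub>2\<^sub>k\<close> is diagonal exactly if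
  \<open>g\<^sub>2\<^sub>k = 0 = e\<^sub>2\<^sub>k\<^sub>+\<^sub>1\<close>, and then it is \<open>diag (K, 1/K)\<close> because its determinant is one. When
  \<open>K \<noteq> 0\<close> these two equations are linear in \<open>s\<^sub>1\<close> and in \<open>s\<^sub>2\<^sub>k\<close> respectively, with coefficient \<open>K\<close>,
  and so determine \<open>s\<^sub>1\<close> and \<open>s\<^sub>2\<^sub>k\<close> as regular functions of the middle coordinates. This gives the
  isomorphisms \<open>variety_iso_B_param\<close> and \<open>variety_iso_stokes_fibre\<close>, and the
  second one, being equivariant, passes to the rings of invariants
  (\<open>variety_iso_affine_quotient\<close>).

  For the two-form, put \<open>p\<^sub>i = P\<^sub>i\<^sup>-\<^sup>1 dP\<^sub>i\<close> and \<open>G = dC C\<^sup>-\<^sup>1\<close>. On the level set \<open>b = 1\<close> and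
  \<open>db = 0\<close>, and all terms containing \<open>G\<close> telescope, so that \<open>2 \<omega> = - \<Sum> (p\<^sub>i, p\<^sub>i\<^sub>-\<^sub>1)\<close>
  (\<open>omega_A_level_set\<close>). Each summand is the pairing of the elementary matrix
  \<open>dS\<^sub>i\<close> with \<open>dP\<^sub>i\<^sub>-\<^sub>1 P\<^sub>i\<^sub>-\<^sub>1\<^sup>-\<^sup>1\<close>. An invariant form sees only the off-diagonal entry of
  the latter, multiplied by the constant \<open>a = (E\<^sub>1\<^sub>2, E\<^sub>2\<^sub>1)\<close>. The sum can be evaluated in closed form
  (\<open>fusion_sum_eq\<close>), with the result
  \<open>\<omega> = (a / K) \<Sum>\<^bsub>i < j\<^esub> (\<partial>\<^sub>i \<partial>\<^sub>j K) ds\<^sub>i \<and> ds\<^sub>j\<close>.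

  The remaining claims concern this explicit form on \<open>K \<noteq> 0\<close>. The numerator
  \<open>\<alpha>\<^sub>n = \<Sum>\<^bsub>i < j\<^esub> (\<partial>\<^sub>i \<partial>\<^sub>j e\<^sub>n) ds\<^sub>i \<and> ds\<^sub>j\<close> satisfies a recurrence in \<open>n\<close> parallel to that of
  \<open>e\<^sub>n\<close>, and what is needed follows by induction along it: \<open>K d\<alpha> = dK \<and> \<alpha>\<close>, which is
  closedness (\<open>alt_hess_closed\<close>); the contraction of \<open>\<alpha>\<close> with the generator of the
  \<open>\<complex>\<^sup>*\<close>-action is \<open>- dK\<close>, which is the moment map property with constant \<open>- a\<close>
  (\<open>alt_hess_weight\<close>); and for every \<open>j\<close> there is an explicit vector whose pairing with \<open>v\<close>
  recovers the coordinate \<open>v\<^sub>j\<close> up to a multiple of \<open>dK (v)\<close>, which is nondegeneracy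
  (\<open>alt_hess_nondegenerate\<close>).
\<close>

section \<open>Continuants as solutions of a linear recurrence\<close>

text \<open>The index of the coefficient is chosen such that \<open>s i\<close> enters in the \<open>i\<close>-th Stokes factor: the
  step from index \<open>i\<close> to \<open>i + 1\<close> uses \<open>s i\<close>.\<close>

fun cont_rec :: "complex \<Rightarrow> complex \<Rightarrow> (nat \<Rightarrow> complex) \<Rightarrow> nat \<Rightarrow> complex" where
  "cont_rec a b s 0 = a"
| "cont_rec a b s (Suc 0) = b"
| "cont_rec a b s (Suc (Suc n)) = s (Suc n) * cont_rec a b s (Suc n) + cont_rec a b s n"

abbreviation (input) numer :: "(nat \<Rightarrow> complex) \<Rightarrow> nat \<Rightarrow> complex"
  where "numer \<equiv> cont_rec 1 0"

abbreviation (input) denom :: "(nat \<Rightarrow> complex) \<Rightarrow> nat \<Rightarrow> complex"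
  where "denom \<equiv> cont_rec 0 1"

text \<open>Continuants are defined by expansion at the first argument, but products of Stokes matrices grow at
  the other end.\<close>

lemma continuant_snoc:
  "continuant (xs @ [y, z]) = z * continuant (xs @ [y]) + continuant xs"
  for y z :: "'a::comm_semiring_1"
  by (induction xs rule: continuant.induct) (auto simp: algebra_simps)

lemma continuant_eq_cont_rec:
  "continuant (map x [2..<n + 2]) = cont_rec 1 0 x (n + 2)"
proof (induction n rule: less_induct)
  case (less n)
  consider "n = 0" | "n = 1" | m where "n = Suc (Suc m)"
    by (metis One_nat_def old.nat.exhaust)
  then show ?case
  proof cases
    case 3
    then show ?thesis
      using continuant_snoc[of "map x [2..<m + 2]" "x (m + 2)" "x (m + 3)"]
        less.IH[of m] less.IH[of "Suc m"] by (simp add: numeral_3_eq_3)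
  qed (simp_all add: numeral_2_eq_2)
qed

lemma euler_eq_cont_rec:
  assumes "k \<ge> 1"
  shows "euler k x = cont_rec 1 0 x (2 * k)"
proof -
  from assms obtain m where "2 * k = m + 2"
    by (metis add.commute le_Suc_ex mult_2 mult_2_right nat_1_add_1 add_le_mono)
  then show ?thesis using continuant_eq_cont_rec[of x m] by (simp only: euler_def)
qed

text \<open>This is the determinant of a product of unipotent matrices; the sign records the exchange of the
  rows at every step.\<close>

lemma wronskian:
  "numer s (Suc n) * denom s n - numer s n * denom s (Suc n) = - ((-1) ^ n)"
proof (induction n)
  case (Suc n)
  then show ?case by (simp add: algebra_simps)
qed simp

text \<open>All terms of a continuant arise by deleting pairs of neighbouring variables, and neighbouring
  variables have opposite weights.\<close>

lemma numer_weight: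
  assumes "c \<noteq> 0"
  shows "numer (scale_act c s) n = (if even n then 1 else inverse c) * numer s n"
proof (induction n rule: induct_nat_012)
  case (ge2 n)
  then show ?case using assms by (auto simp: scale_act_def field_simps)
qed auto

lemma denom_weight:
  assumes "c \<noteq> 0"
  shows "denom (scale_act c s) n = (if even n then c else 1) * denom s n"
proof (induction n rule: induct_nat_012)
  case (ge2 n)
  then show ?case using assms by (auto simp: scale_act_def field_simps)
qed auto

lemma cont_rec_cong:
  assumes "\<And>i. \<lbrakk>1 \<le> i; i < n\<rbrakk> \<Longrightarrow> s i = s' i"
  shows "cont_rec a b s n = cont_rec a b s' n"
  using assms by (induction n rule: induct_nat_012) auto

text \<open>Since \<open>e\<^sub>1 = 0\<close>, the coefficient \<open>s 1\<close> is multiplied by zero.\<close>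

lemma numer_cong:
  assumes "\<And>i. \<lbrakk>2 \<le> i; i < n\<rbrakk> \<Longrightarrow> s i = s' i"
  shows "numer s n = numer s' n"
  using assms
proof (induction n rule: induct_nat_012)
  case (ge2 n)
  then show ?case by (cases n) auto
qed auto

section \<open>First and ordered second variations of the continuant\<close>

fun cont_rec_diff :: "complex \<Rightarrow> complex \<Rightarrow> (nat \<Rightarrow> complex) \<Rightarrow> (nat \<Rightarrow> complex) \<Rightarrow> nat \<Rightarrow> complex" where
  "cont_rec_diff a b s v 0 = 0"
| "cont_rec_diff a b s v (Suc 0) = 0"
| "cont_rec_diff a b s v (Suc (Suc n)) =
     s (Suc n) * cont_rec_diff a b s v (Suc n) + cont_rec_diff a b s v n + v (Suc n) * cont_rec a b s (Suc n)"

abbreviation (input) dnumer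
  where "dnumer \<equiv> cont_rec_diff 1 0"
abbreviation (input) ddenom
  where "ddenom \<equiv> cont_rec_diff 0 1"

lemma has_derivative_cont_rec:
  "((\<lambda>z. cont_rec a b (\<lambda>i. s i + z * v i) n) has_field_derivative
     cont_rec_diff a b (\<lambda>i. s i + z * v i) v n) (at z)"
proof (induction n rule: induct_nat_012)
  case (ge2 n)
  show ?case
    by (rule derivative_eq_intros ge2 refl | simp)+ 
qed auto

lemma wronskian_diff:
  "cont_rec_diff 1 0 s v (Suc n) * denom s n + numer s (Suc n) * cont_rec_diff 0 1 s v n
   = cont_rec_diff 1 0 s v n * denom s (Suc n) + numer s n * cont_rec_diff 0 1 s v (Suc n)"
proof (induction n)
  case (Suc n)
  then show ?case by simp algebra
qed simp

text \<open>The value on \<open>(v, w)\<close> of the two-form \<open>\<Sum>\<^bsub>i < j\<^esub> (\<partial>\<^sub>i \<partial>\<^sub>j e\<^sub>n) ds\<^sub>i \<and> ds\<^sub>j\<close>: since \<open>e\<^sub>n\<close>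
  has degree at most one in each variable, a pair \<open>i < j\<close> either occurs already in one of the two preceding
  terms of the recurrence or has \<open>j\<close> equal to the new index, which contributes \<open>de \<and> ds\<close>.\<close>

fun alt_hess :: "(nat \<Rightarrow> complex) \<Rightarrow> (nat \<Rightarrow> complex) \<Rightarrow> (nat \<Rightarrow> complex) \<Rightarrow> nat \<Rightarrow> complex" where
  "alt_hess s v w 0 = 0"
| "alt_hess s v w (Suc 0) = 0"
| "alt_hess s v w (Suc (Suc n)) = s (Suc n) * alt_hess s v w (Suc n) + alt_hess s v w n
     + (dnumer s v (Suc n) * w (Suc n) - dnumer s w (Suc n) * v (Suc n))"

lemma cont_rec_diff_add: "cont_rec_diff a b s (\<lambda>i. u i + v i) n = cont_rec_diff a b s u n
    + cont_rec_diff a b s v n"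
  by (induction n rule: induct_nat_012) (auto simp: algebra_simps)

lemma cont_rec_diff_scale: "cont_rec_diff a b s (\<lambda>i. c * v i) n = c * cont_rec_diff a b s v n"
  by (induction n rule: induct_nat_012) (auto simp: algebra_simps)

lemma alt_hess_add: "alt_hess s (\<lambda>i. u i + v i) w n = alt_hess s u w n + alt_hess s v w n"
  by (induction n rule: induct_nat_012) (auto simp: algebra_simps cont_rec_diff_add)

lemma alt_hess_scale: "alt_hess s (\<lambda>i. c * v i) w n = c * alt_hess s v w n"
  by (induction n rule: induct_nat_012) (auto simp: algebra_simps cont_rec_diff_scale)

lemma alt_hess_swap: "alt_hess s v w n = - alt_hess s w v n"
  by (induction n rule: induct_nat_012) (auto simp: algebra_simps)

lemma dnumer_cong:
  assumes "\<And>i. \<lbrakk>2 \<le> i; i < n\<rbrakk> \<Longrightarrow> s i = s' i" "\<And>i. \<lbrakk>2 \<le> i; i < n\<rbrakk> \<Longrightarrow> v i = v' i"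
  shows "dnumer s v n = dnumer s' v' n"
  using assms
proof (induction n rule: induct_nat_012)
  case (ge2 n)
  have "numer s (Suc n) = numer s' (Suc n)" by (rule numer_cong) (use ge2.prems in auto)
  with ge2 show ?case by (cases n) auto
qed auto

lemma alt_hess_cong:
  assumes "\<And>i. \<lbrakk>2 \<le> i; i < n\<rbrakk> \<Longrightarrow> s i = s' i" "\<And>i. \<lbrakk>2 \<le> i; i < n\<rbrakk> \<Longrightarrow> v i = v' i"
    "\<And>i. \<lbrakk>2 \<le> i; i < n\<rbrakk> \<Longrightarrow> w i = w' i"
  shows "alt_hess s v w n = alt_hess s' v' w' n"
  using assms
proof (induction n rule: induct_nat_012)
  case (ge2 n)
  have "dnumer s v (Suc n) = dnumer s' v' (Suc n)" "dnumer s w (Suc n) = dnumer s' w' (Suc n)"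
    by (rule dnumer_cong; use ge2.prems in auto)+
  with ge2 show ?case by (cases n) auto
qed auto

text \<open>The generator of the \<open>\<complex>\<^sup>*\<close>-action.\<close>

definition weight_field :: "(nat \<Rightarrow> complex) \<Rightarrow> nat \<Rightarrow> complex" where
  "weight_field s = (\<lambda>i. if odd i then s i else - s i)"

lemma dnumer_weight: "dnumer s (weight_field s) n = (if even n then 0 else - numer s n)"
  by (induction n rule: induct_nat_012) (auto simp: weight_field_def algebra_simps)

text \<open>For even \<open>n\<close> this says that the vector field of weights is Hamiltonian, with Hamiltonian
  \<open>- log e\<^sub>n\<close>, for the form \<open>\<alpha>\<^sub>n / e\<^sub>n\<close>. The odd case is what makes the induction work.\<close>

lemma alt_hess_weight: "alt_hess s (weight_field s) w n = (if even n then - dnumer s w n else 0)"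
proof (induction n rule: induct_nat_012)
  case (ge2 n)
  then show ?case
    by (simp add: dnumer_weight) (simp add: weight_field_def algebra_simps)
qed auto

section \<open>Closedness\<close>

fun hess :: "(nat \<Rightarrow> complex) \<Rightarrow> (nat \<Rightarrow> complex) \<Rightarrow> (nat \<Rightarrow> complex) \<Rightarrow> nat \<Rightarrow> complex" where
  "hess s v w 0 = 0"
| "hess s v w (Suc 0) = 0"
| "hess s v w (Suc (Suc n)) = s (Suc n) * hess s v w (Suc n) + hess s v w n
     + (dnumer s v (Suc n) * w (Suc n) + dnumer s w (Suc n) * v (Suc n))"

lemma hess_swap: "hess s v w n = hess s w v n"
  by (induction n rule: induct_nat_012) auto

fun alt_hess_diff ::
  "(nat \<Rightarrow> complex) \<Rightarrow> (nat \<Rightarrow> complex) \<Rightarrow> (nat \<Rightarrow> complex) \<Rightarrow> (nat \<Rightarrow> complex) \<Rightarrow> nat \<Rightarrow> complex" where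
  "alt_hess_diff s u v w 0 = 0"
| "alt_hess_diff s u v w (Suc 0) = 0"
| "alt_hess_diff s u v w (Suc (Suc n)) = s (Suc n) * alt_hess_diff s u v w (Suc n)
     + alt_hess_diff s u v w n + u (Suc n) * alt_hess s v w (Suc n)
     + (hess s u v (Suc n) * w (Suc n) - hess s u w (Suc n) * v (Suc n))"

lemma has_derivative_dnumer:
  "((\<lambda>z. dnumer (\<lambda>i. s i + z * u i) v n) has_field_derivative
     hess (\<lambda>i. s i + z * u i) u v n) (at z)"
proof (induction n rule: induct_nat_012)
  case (ge2 n)
  show ?case
    by (rule derivative_eq_intros ge2 has_derivative_cont_rec refl | simp)+
qed auto

lemma has_derivative_alt_hess:
  "((\<lambda>z. alt_hess (\<lambda>i. s i + z * u i) v w n) has_field_derivative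
     alt_hess_diff (\<lambda>i. s i + z * u i) u v w n) (at z)"
proof (induction n rule: induct_nat_012)
  case (ge2 n)
  show ?case
    by (rule derivative_eq_intros ge2 has_derivative_dnumer refl | simp)+
qed auto

definition alt_third ::
  "(nat \<Rightarrow> complex) \<Rightarrow> (nat \<Rightarrow> complex) \<Rightarrow> (nat \<Rightarrow> complex) \<Rightarrow> (nat \<Rightarrow> complex) \<Rightarrow> nat \<Rightarrow> complex" where
  "alt_third s u v w n = alt_hess_diff s u v w n + alt_hess_diff s v w u n + alt_hess_diff s w u v n"

text \<open>The third variation \<open>d\<alpha>\<close> obeys the exterior derivative of the recurrence for \<open>\<alpha>\<close>. The contributions of
  \<open>d(de \<and> ds)\<close> cancel by the symmetry of second derivatives.\<close>

lemma alt_third_rec: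
  "alt_third s u v w 0 = 0" "alt_third s u v w (Suc 0) = 0"
  "alt_third s u v w (Suc (Suc n)) = s (Suc n) * alt_third s u v w (Suc n) + alt_third s u v w n
     + (u (Suc n) * alt_hess s v w (Suc n) + v (Suc n) * alt_hess s w u (Suc n)
        + w (Suc n) * alt_hess s u v (Suc n))"
  using hess_swap[of s u v "Suc n"] hess_swap[of s v w "Suc n"] hess_swap[of s u w "Suc n"]
  by (simp_all add: alt_third_def algebra_simps)

text \<open>The value of \<open>de\<^sub>m \<and> \<alpha>\<^sub>n\<close> on \<open>(u, v, w)\<close>.\<close>

definition cyc_wedge ::
  "(nat \<Rightarrow> complex) \<Rightarrow> (nat \<Rightarrow> complex) \<Rightarrow> (nat \<Rightarrow> complex) \<Rightarrow> (nat \<Rightarrow> complex) \<Rightarrow> nat \<Rightarrow> nat \<Rightarrow> complex" where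
  "cyc_wedge s u v w m n = dnumer s u m * alt_hess s v w n + dnumer s v m * alt_hess s w u n
     + dnumer s w m * alt_hess s u v n"

text \<open>Where no \<open>e\<^sub>n\<close> vanishes this is the recursion
  \<open>\<alpha>\<^sub>n\<^sub>+\<^sub>1 / e\<^sub>n\<^sub>+\<^sub>1 = \<alpha>\<^sub>n / e\<^sub>n + dlog e\<^sub>n \<and> dlog e\<^sub>n\<^sub>+\<^sub>1\<close>, which exhibits the form as a sum of closed
  forms. Cleared of denominators it holds everywhere.\<close>

lemma alt_hess_cross:
  "numer s n * alt_hess s v w (Suc n) - numer s (Suc n) * alt_hess s v w n
   = dnumer s v n * dnumer s w (Suc n) - dnumer s w n * dnumer s v (Suc n)"
proof (induction n)
  case (Suc n)
  then show ?case by simp algebra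
qed simp

text \<open>The relation \<open>e\<^sub>n d\<alpha>\<^sub>n = de\<^sub>n \<and> \<alpha>\<^sub>n\<close> expresses that \<open>\<alpha>\<^sub>n / e\<^sub>n\<close> is closed. In the induction step
  products of neighbouring terms of the recurrence appear, so the polarised relation between the indices
  \<open>n\<close> and \<open>n + 1\<close> has to be carried along; the terms with the new differential cancel by
  \<open>alt_hess_cross\<close>.\<close>

lemma alt_hess_closed:
  "numer s (Suc n) * alt_third s u v w n + numer s n * alt_third s u v w (Suc n)
     = cyc_wedge s u v w (Suc n) n + cyc_wedge s u v w n (Suc n) \<and>
   numer s n * alt_third s u v w n = cyc_wedge s u v w n n \<and>
   numer s (Suc n) * alt_third s u v w (Suc n) = cyc_wedge s u v w (Suc n) (Suc n)"
proof (induction n)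
  case (Suc n)
  show ?case
    using Suc alt_hess_cross[of s n u v] alt_hess_cross[of s n v w] alt_hess_cross[of s n w u]
    unfolding cyc_wedge_def alt_third_rec cont_rec.simps cont_rec_diff.simps alt_hess.simps
    by (intro conjI; algebra)
qed (simp add: alt_third_rec cyc_wedge_def)

section \<open>Nondegeneracy\<close>

text \<open>A vector that is dual to the coordinate \<open>s j\<close> modulo \<open>de\<^sub>n\<close>. Below \<open>j - 1\<close> it is proportional to
  the field of weights, so that its pairings are known there; the three entries at \<open>j - 1\<close>, \<open>j\<close> and
  \<open>j + 1\<close> are the solution of the linear equations that make the pairing equal to
  \<open>\<plusminus> v j e\<^sub>n - s j de\<^sub>n (v)\<close> for the two indices after \<open>j\<close>, hence for all later ones.\<close>

definition dual_field :: "(nat \<Rightarrow> complex) \<Rightarrow> nat \<Rightarrow> nat \<Rightarrow> complex" where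
  "dual_field s j = (\<lambda>i. (if i < j then - 2 * s j * weight_field s i else 0)
     - (-1) ^ j * (if i = j - 1 then 1 else if i = j then - (s j)\<^sup>2 else if i = Suc j then -1 else 0))"

lemma dual_field_below:
  assumes "n < j"
  shows "dnumer s (dual_field s j) n = - 2 * s j * dnumer s (weight_field s) n"
    and "alt_hess s v (dual_field s j) n = - 2 * s j * alt_hess s v (weight_field s) n"
proof -
  have eq: "dual_field s j i = (- 2 * s j) * weight_field s i" if "i < n" for i
    using that assms by (auto simp: dual_field_def)
  have "dnumer s (dual_field s j) n = dnumer s (\<lambda>i. (- 2 * s j) * weight_field s i) n"
    by (rule dnumer_cong) (use eq in auto)
  then show "dnumer s (dual_field s j) n = - 2 * s j * dnumer s (weight_field s) n"
    by (simp only: cont_rec_diff_scale)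
  have "alt_hess s v (dual_field s j) n = alt_hess s v (\<lambda>i. (- 2 * s j) * weight_field s i) n"
    by (rule alt_hess_cong) (use eq in auto)
  also have "\<dots> = - 2 * s j * alt_hess s v (weight_field s) n"
    by (subst (1 2) alt_hess_swap) (simp only: alt_hess_scale mult_minus_right)
  finally show "alt_hess s v (dual_field s j) n = - 2 * s j * alt_hess s v (weight_field s) n" .
qed

text \<open>Both sides of either equation satisfy the same recurrence from index \<open>j + 1\<close> on, since the vector has
  no entries beyond \<open>j + 1\<close>; the first two indices are calculated.\<close>

lemma dual_field_above:
  assumes "j \<ge> 2" "n > j"
  shows "dnumer s (dual_field s j) n = s j * numer s n \<and>
         alt_hess s v (dual_field s j) n = (-1) ^ j * v j * numer s n - s j * dnumer s v n"
proof -
  obtain m where j: "j = Suc (Suc m)" using assms(1) by (metis add_2_eq_Suc le_Suc_ex)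
  note w = dnumer_weight alt_hess_swap[of s v "weight_field s"] alt_hess_weight
  have p: "dual_field s j (Suc m) = - 2 * s j * weight_field s (Suc m) - (-1) ^ m"
    "dual_field s j j = (-1) ^ m * (s j)\<^sup>2" "dual_field s j (Suc j) = (-1) ^ m"
    by (simp_all add: dual_field_def j)
  have pz: "dual_field s j i = 0" if "i > Suc j" for i
    using that by (simp add: dual_field_def)
  have l: "m < j" "Suc m < j" by (simp_all add: j)
  note low = dual_field_below[OF l(1)] dual_field_below[OF l(2)]
  \<comment> \<open>the values at \<open>j\<close> depend on the parity; from \<open>j + 1\<close> on only the sign \<open>(-1) ^ j\<close> remains\<close>
  have j1: "dnumer s (dual_field s j) j = (if even m then - numer s (Suc m) else numer s (Suc m)
      + 2 * s j * numer s j)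
     \<and> alt_hess s v (dual_field s j) j
         = (if even m then - 2 * s j * dnumer s v j - dnumer s v (Suc m) else dnumer s v (Suc m))"
    unfolding j cont_rec_diff.simps alt_hess.simps low[unfolded j] w p(1)[unfolded j]
    by (simp add: weight_field_def algebra_simps)
  have j2: "dnumer s (dual_field s j) (Suc j) = s j * numer s (Suc j) \<and>
         alt_hess s v (dual_field s j) (Suc j) = (-1) ^ j * v j * numer s (Suc j) - s j * dnumer s v (Suc j)"
  proof -
    have "numer s (Suc j) = s j * numer s j + numer s (Suc m)"
      "\<And>u. dnumer s u (Suc j) = s j * dnumer s u j + dnumer s u (Suc m) + u j * numer s j"
      "alt_hess s v (dual_field s j) (Suc j) = s j * alt_hess s v (dual_field s j) j
        + alt_hess s v (dual_field s j) (Suc m)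
        + (dnumer s v j * dual_field s j j - dnumer s (dual_field s j) j * v j)"
      by (simp_all add: j)
    moreover have "(-1) ^ j = ((-1) ^ m :: complex)" by (simp add: j)
    ultimately show ?thesis
      using j1 p(2) by (simp add: low w algebra_simps power2_eq_square eq_neg_iff_add_eq_0 split: if_splits)
  qed
  have j3: "dnumer s (dual_field s j) (Suc (Suc j)) = s j * numer s (Suc (Suc j)) \<and>
         alt_hess s v (dual_field s j) (Suc (Suc j)) = (-1) ^ j * v j * numer s (Suc (Suc j))
             - s j * dnumer s v (Suc (Suc j))"
  proof -
    have e: "numer s (Suc j) = s j * numer s j + numer s (Suc m)"
      "dnumer s v (Suc j) = s j * dnumer s v j + dnumer s v (Suc m) + v j * numer s j"
      by (simp_all add: j)
    \<comment> \<open>a sign variable merges the two parities into one polynomial identity\<close>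
    define \<epsilon> :: complex where "\<epsilon> = (-1) ^ m"
    have \<epsilon>: "(-1) ^ j = \<epsilon>" by (simp add: j \<epsilon>_def)
    have "\<epsilon> = (if even m then 1 else - 1)" by (simp add: \<epsilon>_def)
    then have "dnumer s (dual_field s j) j = s j * numer s j - \<epsilon> * numer s (Suc m) - \<epsilon> * s j * numer s j"
      "alt_hess s v (dual_field s j) j = - s j * dnumer s v j - \<epsilon> * s j * dnumer s v j
         - \<epsilon> * dnumer s v (Suc m)"
      using j1 by auto
    then show ?thesis
      using j2[unfolded \<epsilon>, THEN conjunct1] j2[unfolded \<epsilon>, THEN conjunct2] p(3)[folded \<epsilon>_def] e
      unfolding cont_rec.simps cont_rec_diff.simps alt_hess.simps \<epsilon>
      by (intro conjI; algebra)
  qed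
  have "\<forall>i\<in>{n, Suc n}. dnumer s (dual_field s j) i = s j * numer s i \<and>
         alt_hess s v (dual_field s j) i = (-1) ^ j * v j * numer s i - s j * dnumer s v i"
    if "n \<ge> Suc j" for n
    using that
  proof (induction n rule: dec_induct)
    case base
    show ?case using j2 j3 by simp
  next
    case (step n)
    then show ?case using pz[of "Suc n"] by simp (simp add: algebra_simps)
  qed
  from this[of n] assms show ?thesis by simp
qed

text \<open>Pairing with the field of weights shows that a null vector \<open>v\<close> satisfies \<open>de\<^sub>n (v) = 0\<close>; pairing with
  \<open>dual_field s j\<close> then gives \<open>v j e\<^sub>n = 0\<close>.\<close>

lemma alt_hess_nondegenerate:
  assumes "numer s n \<noteq> 0" "even n" "2 \<le> j" "j < n"
    and null: "\<And>w. alt_hess s v w n = 0"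
  shows "v j = 0"
  using dual_field_above[OF assms(3,4), of s v] null[of "dual_field s j"] null[of "weight_field s"]
    alt_hess_swap[of s v "weight_field s" n] alt_hess_weight[of s v n] assms(1,2)
  by simp

section \<open>The sum of the fusion terms\<close>

text \<open>Up to sign, the off-diagonal entry of \<open>dP\<^sub>n\<^sub>-\<^sub>1 P\<^sub>n\<^sub>-\<^sub>1\<^sup>-\<^sup>1\<close> that pairs with \<open>dS\<^sub>n\<close>.\<close>

definition log_deriv_entry :: "(nat \<Rightarrow> complex) \<Rightarrow> (nat \<Rightarrow> complex) \<Rightarrow> nat \<Rightarrow> complex" where
  "log_deriv_entry s v n = denom s n * dnumer s v n - numer s n * ddenom s v n"

text \<open>Divided by the normalisation of the bilinear form, the sum of the pairings of the successive
  logarithmic derivatives \<open>P\<^sub>i\<^sup>-\<^sup>1 dP\<^sub>i\<close> and \<open>P\<^sub>i\<^sub>-\<^sub>1\<^sup>-\<^sup>1 dP\<^sub>i\<^sub>-\<^sub>1\<close>.\<close>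

fun fusion_sum :: "(nat \<Rightarrow> complex) \<Rightarrow> (nat \<Rightarrow> complex) \<Rightarrow> (nat \<Rightarrow> complex) \<Rightarrow> nat \<Rightarrow> complex" where
  "fusion_sum s v w 0 = 0"
| "fusion_sum s v w (Suc n) = fusion_sum s v w n
    + (-1) ^ n * (v (Suc n) * log_deriv_entry s w (Suc n) - w (Suc n) * log_deriv_entry s v (Suc n))"

text \<open>The two-form \<open>e de' \<and> dg - g de' \<and> de - e' de \<and> dg\<close>, where the dash marks index \<open>n\<close> and its
  absence index \<open>n + 1\<close>. Every term contains \<open>g\<close> or \<open>dg\<close> at index \<open>n + 1\<close>, so that for odd \<open>n\<close> the form
  vanishes as soon as \<open>P\<^sub>n\<^sub>+\<^sub>1\<close> is constrained to be diagonal.\<close>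

definition fusion_rest :: "(nat \<Rightarrow> complex) \<Rightarrow> (nat \<Rightarrow> complex) \<Rightarrow> (nat \<Rightarrow> complex) \<Rightarrow> nat \<Rightarrow> complex" where
  "fusion_rest s v w n = 
    numer s (Suc n) * (dnumer s v n * ddenom s w (Suc n) - dnumer s w n * ddenom s v (Suc n))
   - denom s (Suc n) * (dnumer s v n * dnumer s w (Suc n) - dnumer s w n * dnumer s v (Suc n))
   - numer s n * (dnumer s v (Suc n) * ddenom s w (Suc n) - dnumer s w (Suc n) * ddenom s v (Suc n))"

text \<open>Up to the remainder the sum of the fusion terms is thus \<open>- 2 \<alpha> / e\<close>. The induction step uses the two
  preceding indices and is a polynomial identity modulo the Wronskian relation and its derivatives.\<close>

lemma fusion_sum_eq:
  "numer s (Suc n) * fusion_sum s v w n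
   = - 2 * alt_hess s v w (Suc n) - (-1) ^ n * fusion_rest s v w n"
proof (induction n rule: induct_nat_012)
  case (ge2 n)
  define \<epsilon> :: complex where "\<epsilon> = (-1) ^ n"
  have e2: "\<epsilon> * \<epsilon> = 1" by (simp add: \<epsilon>_def flip: power_add mult_2)
  show ?case
    using ge2 wronskian[of s n] wronskian_diff[of s v n] wronskian_diff[of s w n]  e2
    unfolding cont_rec.simps cont_rec_diff.simps alt_hess.simps fusion_sum.simps
        fusion_rest_def log_deriv_entry_def
      power_Suc \<epsilon>_def[symmetric]
    by algebra
qed (simp_all add: fusion_rest_def log_deriv_entry_def)

section \<open>Regular functions and isomorphisms of varieties\<close>

text \<open>Regularity at one point is easier to combine than membership in the ring of regular functions,
  because the functions need not vanish outside of the variety.\<close>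

definition regular_at :: "('p \<Rightarrow> complex) set \<Rightarrow> 'p set \<Rightarrow> ('p \<Rightarrow> complex) \<Rightarrow> 'p \<Rightarrow> bool" where
  "regular_at coords X f p \<longleftrightarrow>
     (\<exists>g\<in>polynomial_functions coords. \<exists>d\<in>polynomial_functions coords.
        d p \<noteq> 0 \<and> (\<forall>x\<in>X. d x \<noteq> 0 \<longrightarrow> f x = g x / d x))"

lemma regular_functions_iff:
  "f \<in> regular_functions coords X \<longleftrightarrow> (\<forall>x. x \<notin> X \<longrightarrow> f x = 0) \<and> (\<forall>p\<in>X. regular_at coords X f p)"
  by (auto simp: regular_functions_def regular_at_def)

lemma regular_atI:
  assumes "g \<in> polynomial_functions coords" "d \<in> polynomial_functions coords" "d p \<noteq> 0"
    "\<And>x. \<lbrakk>x \<in> X; d x \<noteq> 0\<rbrakk> \<Longrightarrow> f x = g x / d x"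
  shows "regular_at coords X f p"
  using assms unfolding regular_at_def by blast

lemma regular_at_polynomial:
  "f \<in> polynomial_functions coords \<Longrightarrow> regular_at coords X f p"
  by (rule regular_atI[where g = f and d = "\<lambda>_. 1"]) (auto intro: polynomial_functions.const)

lemma regular_at_const: "regular_at coords X (\<lambda>_. c) p"
  by (intro regular_at_polynomial polynomial_functions.const)

lemma regular_at_add:
  assumes "regular_at coords X f p" "regular_at coords X g p"
  shows "regular_at coords X (\<lambda>x. f x + g x) p"
proof -
  obtain n d n' d' where *: "n \<in> polynomial_functions coords" "d \<in> polynomial_functions coords"
    "n' \<in> polynomial_functions coords" "d' \<in> polynomial_functions coords" "d p \<noteq> 0" "d' p \<noteq> 0"
    "\<And>x. \<lbrakk>x \<in> X; d x \<noteq> 0\<rbrakk> \<Longrightarrow> f x = n x / d x" "\<And>x. \<lbrakk>x \<in> X; d' x \<noteq> 0\<rbrakk> \<Longrightarrow> g x = n' x / d' x"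
    using assms unfolding regular_at_def by metis
  show ?thesis
    by (rule regular_atI[where g = "\<lambda>x. n x * d' x + n' x * d x" and d = "\<lambda>x. d x * d' x"])
      (auto intro!: polynomial_functions.intros(3,4) * simp: * field_simps)
qed

lemma regular_at_mult:
  assumes "regular_at coords X f p" "regular_at coords X g p"
  shows "regular_at coords X (\<lambda>x. f x * g x) p"
proof -
  obtain n d n' d' where *: "n \<in> polynomial_functions coords" "d \<in> polynomial_functions coords"
    "n' \<in> polynomial_functions coords" "d' \<in> polynomial_functions coords" "d p \<noteq> 0" "d' p \<noteq> 0"
    "\<And>x. \<lbrakk>x \<in> X; d x \<noteq> 0\<rbrakk> \<Longrightarrow> f x = n x / d x" "\<And>x. \<lbrakk>x \<in> X; d' x \<noteq> 0\<rbrakk> \<Longrightarrow> g x = n' x / d' x"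
    using assms unfolding regular_at_def by metis
  show ?thesis
    by (rule regular_atI[where g = "\<lambda>x. n x * n' x" and d = "\<lambda>x. d x * d' x"])
      (auto intro!: polynomial_functions.intros(3,4) * simp: * field_simps)
qed

lemma regular_at_cong:
  assumes "\<And>x. x \<in> X \<Longrightarrow> f x = g x" "regular_at coords X g p"
  shows "regular_at coords X f p"
  using assms unfolding regular_at_def by metis

lemma regular_at_diff:
  assumes "regular_at coords X f p" "regular_at coords X g p"
  shows "regular_at coords X (\<lambda>x. f x - g x) p"
  using regular_at_add[OF assms(1) regular_at_mult[OF regular_at_const[of _ _ "-1"] assms(2)]]
  by simp

text \<open>The denominator is multiplied into both parts of the fraction, so that the new denominator still
  vanishes wherever the old representation was not available.\<close>

lemma regular_at_inverse:
  assumes "regular_at coords X f p" "f p \<noteq> 0" "p \<in> X"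
  shows "regular_at coords X (\<lambda>x. inverse (f x)) p"
proof -
  obtain n d where *: "n \<in> polynomial_functions coords" "d \<in> polynomial_functions coords"
    "d p \<noteq> 0" "\<And>x. \<lbrakk>x \<in> X; d x \<noteq> 0\<rbrakk> \<Longrightarrow> f x = n x / d x"
    using assms unfolding regular_at_def by metis
  have "n p \<noteq> 0" using *(3,4) assms(2,3) by auto
  then show ?thesis
    by (intro regular_atI[where g = "\<lambda>x. d x * d x" and d = "\<lambda>x. n x * d x"])
      (auto intro!: polynomial_functions.intros(3,4) * simp: * field_simps)
qed

lemma regular_at_local:
  assumes "regular_at coords X h p" "regular_at coords X e p" "e p \<noteq> 0" "p \<in> X"
    and "\<And>x. \<lbrakk>x \<in> X; e x \<noteq> 0\<rbrakk> \<Longrightarrow> f x = h x"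
  shows "regular_at coords X f p"
proof -
  obtain n d n' d' where *: "n \<in> polynomial_functions coords" "d \<in> polynomial_functions coords"
    "n' \<in> polynomial_functions coords" "d' \<in> polynomial_functions coords" "d p \<noteq> 0" "d' p \<noteq> 0"
    "\<And>x. \<lbrakk>x \<in> X; d x \<noteq> 0\<rbrakk> \<Longrightarrow> h x = n x / d x" "\<And>x. \<lbrakk>x \<in> X; d' x \<noteq> 0\<rbrakk> \<Longrightarrow> e x = n' x / d' x"
    using assms(1,2) unfolding regular_at_def by metis
  show ?thesis
    by (rule regular_atI[where g = "\<lambda>x. n x * (d' x * n' x)" and d = "\<lambda>x. d x * (d' x * n' x)"])
      (use assms(3,4) *(8)[of p] *(5,6) in
        \<open>auto intro!: polynomial_functions.intros(3,4) *(1-4) simp: assms(5) *(7,8)\<close>)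
qed

lemma regular_at_polynomial_comp:
  assumes "g \<in> polynomial_functions coordsY"
    and "\<And>y. y \<in> coordsY \<Longrightarrow> regular_at coordsX X (\<lambda>x. y (\<phi> x)) p"
  shows "regular_at coordsX X (\<lambda>x. g (\<phi> x)) p"
  using assms(1)
proof induction
  case (coord y)
  then show ?case by (rule assms(2))
qed (intro regular_at_const regular_at_add regular_at_mult; assumption)+

lemma pull_back_regular:
  assumes f: "f \<in> regular_functions coordsY Y" and \<phi>: "\<And>x. x \<in> X \<Longrightarrow> \<phi> x \<in> Y"
    and coords: "\<And>y p. \<lbrakk>y \<in> coordsY; p \<in> X\<rbrakk> \<Longrightarrow> regular_at coordsX X (\<lambda>x. y (\<phi> x)) p"
  shows "pull_back X \<phi> f \<in> regular_functions coordsX X"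
  unfolding regular_functions_iff
proof (intro conjI allI impI ballI)
  fix p assume p: "p \<in> X"
  have "regular_at coordsY Y f (\<phi> p)" using f \<phi>[OF p] by (simp add: regular_functions_iff)
  then obtain n d where *: "n \<in> polynomial_functions coordsY" "d \<in> polynomial_functions coordsY"
    "d (\<phi> p) \<noteq> 0" "\<And>x. \<lbrakk>x \<in> Y; d x \<noteq> 0\<rbrakk> \<Longrightarrow> f x = n x / d x"
    unfolding regular_at_def by blast
  note reg = regular_at_polynomial_comp[OF _ coords[OF _ p]]
  show "regular_at coordsX X (pull_back X \<phi> f) p"
  proof (rule regular_at_local)
    show "regular_at coordsX X (\<lambda>x. n (\<phi> x) * inverse (d (\<phi> x))) p"
      by (intro regular_at_mult regular_at_inverse reg[OF *(1)] reg[OF *(2)] *(3) p)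
    show "regular_at coordsX X (\<lambda>x. d (\<phi> x)) p" by (rule reg[OF *(2)])
  qed (use * p \<phi> in \<open>auto simp: pull_back_def divide_inverse\<close>)
qed (auto simp: pull_back_def)

lemma variety_iso_subvariety:
  assumes maps: "\<And>x. x \<in> X \<Longrightarrow> \<phi> x \<in> Y" "\<And>y. y \<in> Y \<Longrightarrow> \<psi> y \<in> X"
    and inv: "\<And>x. x \<in> X \<Longrightarrow> \<psi> (\<phi> x) = x" "\<And>y. y \<in> Y \<Longrightarrow> \<phi> (\<psi> y) = y"
    and coords: "\<And>y p. \<lbrakk>y \<in> coordsY; p \<in> X\<rbrakk> \<Longrightarrow> regular_at coordsX X (\<lambda>x. y (\<phi> x)) p"
      "\<And>x p. \<lbrakk>x \<in> coordsX; p \<in> Y\<rbrakk> \<Longrightarrow> regular_at coordsY Y (\<lambda>y. x (\<psi> y)) p"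
  shows "variety_iso \<phi> (subvariety coordsX X) (subvariety coordsY Y)"
proof -
  have "bij_betw \<phi> X Y"
    by (rule bij_betw_byWitness[where f' = \<psi>]) (use maps inv in auto)
  moreover have "pull_back X \<phi> ` regular_functions coordsY Y = regular_functions coordsX X"
  proof safe
    fix f assume "f \<in> regular_functions coordsY Y"
    then show "pull_back X \<phi> f \<in> regular_functions coordsX X"
      by (rule pull_back_regular) (fact maps coords)+
  next
    fix f assume f: "f \<in> regular_functions coordsX X"
    then have "pull_back Y \<psi> f \<in> regular_functions coordsY Y"
      by (rule pull_back_regular) (fact maps coords)+
    moreover have "f = pull_back X \<phi> (pull_back Y \<psi> f)"
      using f maps inv by (auto simp: pull_back_def regular_functions_iff fun_eq_iff)
    ultimately show "f \<in> pull_back X \<phi> ` regular_functions coordsY Y" by blast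
  qed
  ultimately show ?thesis by (simp add: variety_iso_def subvariety_def)
qed

lemma regular_functions_ring:
  shows "(\<lambda>x. if x \<in> X then c else 0) \<in> regular_functions coords X"
    and "\<lbrakk>f \<in> regular_functions coords X; g \<in> regular_functions coords X\<rbrakk>
      \<Longrightarrow> (\<lambda>x. f x + g x) \<in> regular_functions coords X"
    and "\<lbrakk>f \<in> regular_functions coords X; g \<in> regular_functions coords X\<rbrakk>
      \<Longrightarrow> (\<lambda>x. f x * g x) \<in> regular_functions coords X"
proof -
  show "(\<lambda>x. if x \<in> X then c else 0) \<in> regular_functions coords X"
    unfolding regular_functions_iff
    by (auto intro!: regular_at_local[OF regular_at_const[of _ _ c] regular_at_const[of _ _ 1]])
qed (auto simp: regular_functions_iff intro: regular_at_add regular_at_mult)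

section \<open>Affine quotients\<close>

text \<open>Pulling back along \<open>\<phi>\<close> is an isomorphism of the rings of functions. Equivariance, together with the
  surjectivity of \<open>\<pi>\<close>, makes it restrict to an isomorphism of the rings of invariants, and the points
  and functions of the affine quotients depend on these rings only.\<close>

lemma variety_iso_affine_quotient:
  fixes X :: "'p variety" and Y :: "'r variety"
  assumes iso: "variety_iso \<phi> X Y"
    and zero: "\<And>f y. \<lbrakk>f \<in> snd Y; y \<notin> fst Y\<rbrakk> \<Longrightarrow> f y = 0"
    and const: "\<And>c. (\<lambda>y. if y \<in> fst Y then c else 0) \<in> snd Y"
    and add: "\<And>f g. \<lbrakk>f \<in> snd Y; g \<in> snd Y\<rbrakk> \<Longrightarrow> (\<lambda>y. f y + g y) \<in> snd Y"
    and mult: "\<And>f g. \<lbrakk>f \<in> snd Y; g \<in> snd Y\<rbrakk> \<Longrightarrow> (\<lambda>y. f y * g y) \<in> snd Y"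
    and group: "\<pi> ` \<Gamma> = \<Gamma>'"
    and act: "\<And>g x. \<lbrakk>g \<in> \<Gamma>; x \<in> fst X\<rbrakk> \<Longrightarrow> act g x \<in> fst X"
    and equivariant: "\<And>g x. \<lbrakk>g \<in> \<Gamma>; x \<in> fst X\<rbrakk> \<Longrightarrow> \<phi> (act g x) = act' (\<pi> g) (\<phi> x)"
  shows "variety_iso (quotient_map (fst X) (invariant_ring \<Gamma>' act' Y) \<phi>)
    (affine_quotient \<Gamma> act X) (affine_quotient \<Gamma>' act' Y)"
proof -
  define R where "R = invariant_ring \<Gamma> act X"
  define R' where "R' = invariant_ring \<Gamma>' act' Y"
  define P where "P = algebra_points (fst X) R"
  define P' where "P' = algebra_points (fst Y) R'"
  define T where "T = pull_back (fst X) \<phi>"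
  define Q where "Q = quotient_map (fst X) R' \<phi>"
  have bij: "bij_betw \<phi> (fst X) (fst Y)" and img: "T ` snd Y = snd X"
    using iso by (auto simp: variety_iso_def T_def)
  have \<phi>: "\<phi> x \<in> fst Y" if "x \<in> fst X" for x using bij that by (auto simp: bij_betw_def)
  have act': "act' g' y \<in> fst Y" if gy: "g' \<in> \<Gamma>'" "y \<in> fst Y" for g' y
  proof -
    obtain g x where gx: "g \<in> \<Gamma>" "g' = \<pi> g" "x \<in> fst X" "y = \<phi> x"
      using gy group bij_betw_imp_surj_on[OF bij] by blast
    show ?thesis
      using \<phi>[OF act[OF gx(1,3)]] by (simp add: gx equivariant)
  qed
  have T_inv: "T f \<in> R \<longleftrightarrow> f \<in> R'" if "f \<in> snd Y" for f
  proof -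
    have "f (act' g' y) = f y"
      if inv: "\<forall>g\<in>\<Gamma>. \<forall>x\<in>fst X. T f (act g x) = T f x" and gy: "g' \<in> \<Gamma>'" "y \<in> fst Y" for g' y
    proof -
      obtain g x where "g \<in> \<Gamma>" "g' = \<pi> g" "x \<in> fst X" "y = \<phi> x"
        using gy group bij_betw_imp_surj_on[OF bij] by blast
      with inv act show ?thesis by (auto simp: T_def pull_back_def equivariant)
    qed
    moreover have "T f (act g x) = T f x"
      if "\<forall>g\<in>\<Gamma>'. \<forall>x\<in>fst Y. f (act' g x) = f x" "g \<in> \<Gamma>" "x \<in> fst X" for g x
      using that act group \<phi> by (auto simp: T_def pull_back_def equivariant)
    ultimately show ?thesis
      using that img unfolding R_def R'_def invariant_ring_def by blast
  qed
  have R'_sub: "R' \<subseteq> snd Y" by (auto simp: R'_def invariant_ring_def)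
  have T_img: "T ` R' = R"
  proof -
    have "R \<subseteq> T ` snd Y" using img by (auto simp: R_def invariant_ring_def)
    then show ?thesis using T_inv R'_sub by blast
  qed
  have T_inj: "inj_on T R'"
  proof (rule inj_onI)
    fix f g assume fg: "f \<in> R'" "g \<in> R'" "T f = T g"
    have "f y = g y" for y
    proof (cases "y \<in> fst Y")
      case True
      then obtain x where "x \<in> fst X" "y = \<phi> x" using bij by (auto simp: bij_betw_def)
      then show ?thesis using fun_cong[OF fg(3), of x] by (simp add: T_def pull_back_def)
    qed (use fg R'_sub zero in \<open>metis subsetD\<close>)
    then show "f = g" by blast
  qed
  have ring': "(\<lambda>y. if y \<in> fst Y then c else 0) \<in> R'"
    "\<lbrakk>f \<in> R'; g \<in> R'\<rbrakk> \<Longrightarrow> (\<lambda>y. f y + g y) \<in> R'"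
    "\<lbrakk>f \<in> R'; g \<in> R'\<rbrakk> \<Longrightarrow> (\<lambda>y. f y * g y) \<in> R'" for f g c
    using const add mult act' by (auto simp: R'_def invariant_ring_def)
  have T_ring: "T (\<lambda>y. if y \<in> fst Y then c else 0) = (\<lambda>x. if x \<in> fst X then c else 0)"
    "T (\<lambda>y. f y + g y) = (\<lambda>x. T f x + T g x)" "T (\<lambda>y. f y * g y) = (\<lambda>x. T f x * T g x)" for f g c
    using \<phi> by (auto simp: T_def pull_back_def)
  have Q_apply: "Q ev f = (if f \<in> R' then ev (T f) else 0)" for ev f
    by (simp add: Q_def quotient_map_def T_def)
  have TR: "T f \<in> R" if "f \<in> R'" for f using T_img that by blast
  have Q_bij: "bij_betw Q P P'"
  proof (rule bij_betwI')
    fix ev ev' assume ev: "ev \<in> P" "ev' \<in> P"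
    have "ev f = ev' f" if "Q ev = Q ev'" for f
    proof (cases "f \<in> R")
      case True
      then obtain f' where "f' \<in> R'" "f = T f'" using T_img by blast
      then show ?thesis using fun_cong[OF that, of f'] by (simp add: Q_apply)
    qed (use ev in \<open>auto simp: P_def algebra_points_def\<close>)
    then show "Q ev = Q ev' \<longleftrightarrow> ev = ev'" by auto
  next
    fix ev assume ev: "ev \<in> P"
    show "Q ev \<in> P'"
      using ev ring' TR unfolding P_def P'_def algebra_points_def mem_Collect_eq Q_apply
      by (auto simp: T_ring)
  next
    fix ev' assume ev': "ev' \<in> P'"
    define ev where "ev = (\<lambda>f. if f \<in> R then ev' (inv_into R' T f) else 0)"
    have ev_T: "ev (T f) = ev' f" if "f \<in> R'" for f
      using that TR T_inj by (simp add: ev_def inv_into_f_f)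
    have "ev \<in> P"
      unfolding P_def algebra_points_def mem_Collect_eq
    proof (intro conjI allI impI ballI)
      fix c
      show "ev (\<lambda>x. if x \<in> fst X then c else 0) = c"
        using ev_T[OF ring'(1)[of c]] ev' by (simp add: T_ring P'_def algebra_points_def)
    next
      fix f g assume "f \<in> R" "g \<in> R"
      then obtain f' g' where "f' \<in> R'" "g' \<in> R'" "f = T f'" "g = T g'" using T_img by blast
      then show "ev (\<lambda>x. f x + g x) = ev f + ev g" "ev (\<lambda>x. f x * g x) = ev f * ev g"
        using ev' ring' ev_T by (auto simp: P'_def algebra_points_def simp flip: T_ring)
    qed (simp add: ev_def)
    moreover have "Q ev = ev'"
      using ev' ev_T by (auto simp: Q_apply fun_eq_iff P'_def algebra_points_def)
    ultimately show "\<exists>ev\<in>P. ev' = Q ev" by blast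
  qed
  have pull: "pull_back P Q (\<lambda>ev. if ev \<in> P' then ev f else 0) = (\<lambda>ev. if ev \<in> P then ev (T f) else 0)"
    if "f \<in> R'" for f
    using that Q_bij by (auto simp: pull_back_def Q_apply bij_betw_def fun_eq_iff)
  have "pull_back P Q ` {F. \<exists>f\<in>R'. F = (\<lambda>ev. if ev \<in> P' then ev f else 0)}
    = {F. \<exists>f\<in>R. F = (\<lambda>ev. if ev \<in> P then ev f else 0)}" (is "?L = ?M")
  proof
    show "?L \<subseteq> ?M" using pull TR by blast
    show "?M \<subseteq> ?L"
    proof
      fix F assume "F \<in> ?M"
      then obtain f where f: "f \<in> R'" "F = (\<lambda>ev. if ev \<in> P then ev (T f) else 0)"
        using T_img by blast
      show "F \<in> ?L"
        unfolding f(2) pull[OF f(1), symmetric] using f(1) by blast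
    qed
  qed
  then show ?thesis
    using Q_bij
    by (simp add: variety_iso_def affine_quotient_def Let_def P_def P'_def R_def R'_def Q_def)
qed

section \<open>Stokes data and continuants\<close>

lemma mat2_eq_iff:
  "A = B \<longleftrightarrow> A$1$1 = B$1$1 \<and> A$1$2 = B$1$2 \<and> A$2$1 = B$2$1 \<and> A$2$2 = B$2$2" for A B :: mat2
  by (auto simp: vec_eq_iff forall_2)

lemma mat2_mult_nth: "(A ** B) $ i $ j = A$i$1 * B$1$j + A$i$2 * B$2$j" for A B :: mat2
  by (simp add: matrix_matrix_mult_def sum_2)

lemma mat2_add_rdistrib: "(A + B) ** C = A ** C + B ** C" for A B C :: mat2
  by (simp add: mat2_eq_iff mat2_mult_nth algebra_simps)

lemma mat2_one_nth: "(mat 1 :: mat2) $ i $ j = (if i = j then 1 else 0)"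
  by (simp add: mat_def)

lemma diag2_nth [simp]:
  "diag2 a d $ 1 $ 1 = a" "diag2 a d $ 1 $ 2 = 0" "diag2 a d $ 2 $ 1 = 0" "diag2 a d $ 2 $ 2 = d"
  by (simp_all add: diag2_def)

text \<open>One-sided inverses of square matrices are two-sided, so the choice in the definition of the inverse
  is forced.\<close>

lemma matrix_inv_eqI:
  fixes A B :: mat2
  assumes "A ** B = mat 1"
  shows "matrix_inv A = B"
proof -
  have BA: "B ** A = mat 1" using assms matrix_left_right_inverse by blast
  have "\<exists>B. A ** B = mat 1 \<and> B ** A = mat 1" using assms BA by blast
  from someI_ex[OF this] have "A ** matrix_inv A = mat 1"
    by (simp add: matrix_inv_def)
  then have "B = B ** (A ** matrix_inv A)" by simp
  also have "\<dots> = matrix_inv A" by (simp add: BA matrix_mul_assoc)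
  finally show ?thesis ..
qed

lemma matrix_inv_torus:
  assumes "t \<in> torus"
  shows "matrix_inv t = diag2 (inverse (t$1$1)) (inverse (t$2$2))"
  using assms by (intro matrix_inv_eqI) (simp add: mat2_eq_iff mat2_mult_nth mat2_one_nth torus_def)

definition stokes_tuple :: "nat \<Rightarrow> (nat \<Rightarrow> complex) \<Rightarrow> nat \<Rightarrow> mat2" where
  "stokes_tuple k s = (\<lambda>i. if i \<in> {1..2*k} then
     (if odd i then vector [vector [1, s i], vector [0, 1]]
      else vector [vector [1, 0], vector [s i, 1]]) else 0)"

definition entries :: "(nat \<Rightarrow> mat2) \<Rightarrow> nat \<Rightarrow> complex" where
  "entries S = (\<lambda>i. if odd i then S i $1$2 else S i $2$1)"

lemma stokes_tuple_in_stokes: "stokes_tuple k s \<in> stokes k"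
  by (auto simp: stokes_tuple_def stokes_def U_plus_def U_minus_def)

lemma entries_stokes_tuple: "i \<in> {1..2*k} \<Longrightarrow> entries (stokes_tuple k s) i = s i"
  by (simp add: stokes_tuple_def entries_def)

lemma stokes_nth:
  assumes "S \<in> stokes k" "i \<in> {1..2*k}"
  shows "S i $1$1 = 1" "S i $2$2 = 1"
    "S i $1$2 = (if odd i then entries S i else 0)" "S i $2$1 = (if odd i then 0 else entries S i)"
proof -
  have "S i \<in> (if odd i then U_plus else U_minus)" using assms by (simp only: stokes_def mem_Collect_eq)
  then show "S i $1$1 = 1" "S i $2$2 = 1" "S i $1$2 = (if odd i then entries S i else 0)"
    "S i $2$1 = (if odd i then 0 else entries S i)"
    by (auto simp: U_plus_def U_minus_def entries_def split: if_splits)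
qed

lemma stokes_tuple_entries:
  assumes "S \<in> stokes k"
  shows "stokes_tuple k (entries S) = S"
proof
  fix i
  show "stokes_tuple k (entries S) i = S i"
  proof (cases "i \<in> {1..2*k}")
    case True
    then show ?thesis
      using stokes_nth[OF assms True] by (simp add: stokes_tuple_def mat2_eq_iff)
  next
    case False
    then show ?thesis
      using assms by (auto simp: stokes_tuple_def stokes_def)
  qed
qed

lemma stokes_tuple_cong:
  "(\<And>i. i \<in> {1..2*k} \<Longrightarrow> s i = s' i) \<Longrightarrow> stokes_tuple k s = stokes_tuple k s'"
  by (auto simp: stokes_tuple_def fun_eq_iff)

definition continuant_matrix :: "(nat \<Rightarrow> complex) \<Rightarrow> nat \<Rightarrow> mat2" where
  "continuant_matrix s n = (if even n
     then vector [vector [numer s n, denom s n], vector [numer s (Suc n), denom s (Suc n)]]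
     else vector [vector [numer s (Suc n), denom s (Suc n)], vector [numer s n, denom s n]])"

text \<open>An upper unipotent factor adds a multiple of the second row to the first, a lower one a multiple of
  the first row to the second; in both cases the older row is replaced by the next term of the recurrence.\<close>

lemma stokes_prod_eq:
  assumes "S \<in> stokes k" "n \<le> 2 * k"
  shows "stokes_prod S n = continuant_matrix (entries S) n"
  using assms(2)
proof (induction n)
  case (Suc n)
  then show ?case
    using stokes_nth[OF assms(1), of "Suc n"]
    by (simp add: mat2_eq_iff mat2_mult_nth continuant_matrix_def)
qed (simp add: mat2_eq_iff mat2_one_nth continuant_matrix_def)

lemma stokes_prod_eq_diag2_iff:
  assumes "S \<in> stokes k" "q \<noteq> 0"
  shows "stokes_prod S (2*k) = diag2 (inverse q) q \<longleftrightarrow>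
    numer (entries S) (2*k) = inverse q \<and> numer (entries S) (Suc (2*k)) = 0 \<and> denom (entries S) (2*k) = 0"
proof -
  have "denom (entries S) (Suc (2*k)) = q"
    if "numer (entries S) (2*k) = inverse q" "denom (entries S) (2*k) = 0"
  proof -
    have "inverse q * denom (entries S) (Suc (2*k)) = 1"
      using wronskian[of "entries S" "2*k"] that by (simp del: cont_rec.simps)
    then show ?thesis using assms(2) by (simp add: field_simps del: cont_rec.simps)
  qed
  then show ?thesis
    by (auto simp: stokes_prod_eq[OF assms(1)] continuant_matrix_def mat2_eq_iff simp del: cont_rec.simps)
qed

lemma Bspace_iff:
  "(S, h) \<in> Bspace k \<longleftrightarrow> S \<in> stokes k \<and> numer (entries S) (2*k) \<noteq> 0 \<and>
     numer (entries S) (Suc (2*k)) = 0 \<and> denom (entries S) (2*k) = 0 \<and>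
     h = diag2 (inverse (numer (entries S) (2*k))) (numer (entries S) (2*k))"
  (is "_ \<longleftrightarrow> ?R")
proof (cases "S \<in> stokes k")
  case True
  let ?e = "numer (entries S) (2*k)" and ?g' = "denom (entries S) (Suc (2*k))"
  have w: "?e * ?g' = 1" if "denom (entries S) (2*k) = 0"
    using wronskian[of "entries S" "2*k"] that by (simp del: cont_rec.simps)
  have "h $ 1 $ 1 = inverse ?e" "h $ 2 $ 2 = ?e"
    if "denom (entries S) (2*k) = 0" "h $ 1 $ 1 * ?e = 1" "h $ 2 $ 2 * ?g' = 1"
    using w[OF that(1)] that(2,3)
    by (metis inverse_unique mult.commute, metis inverse_unique mult.commute)
  with w True show ?thesis
    by (auto simp: Bspace_def stokes_prod_eq continuant_matrix_def mat2_eq_iff mat2_mult_nth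
        mat2_one_nth torus_def mult.commute[of _ "cont_rec 0 1 s n" for s n] simp del: cont_rec.simps)
qed (simp add: Bspace_def)

section \<open>Recovering the Stokes data from the middle coordinates\<close>

text \<open>The two outer coefficients are the solutions of \<open>g\<^sub>2\<^sub>k = 0\<close> and \<open>e\<^sub>2\<^sub>k\<^sub>+\<^sub>1 = 0\<close>. On the coordinate space
  \<open>x 1 = 0\<close>, so \<open>denom x (2*k)\<close> is the constant term of \<open>g\<^sub>2\<^sub>k\<close> as a polynomial in the first
  coefficient.\<close>

definition complete_seq :: "nat \<Rightarrow> (nat \<Rightarrow> complex) \<Rightarrow> nat \<Rightarrow> complex" where
  "complete_seq k x = x(1 := - denom x (2*k) / numer x (2*k),
                        2*k := - numer x (2*k - 1) / numer x (2*k))"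

text \<open>The difference of the two sequences satisfies the same recurrence as \<open>e\<close> from index \<open>1\<close> on.\<close>

lemma denom_shift:
  assumes "\<And>i. \<lbrakk>2 \<le> i; i < n\<rbrakk> \<Longrightarrow> s i = x i" "n \<ge> 1"
  shows "denom s n = denom x n + (s 1 - x 1) * numer x n"
proof -
  have "denom s (Suc m) = denom x (Suc m) + (s 1 - x 1) * numer x (Suc m)"
    if "\<And>i. \<lbrakk>2 \<le> i; i < Suc m\<rbrakk> \<Longrightarrow> s i = x i" for m
    using that
  proof (induction m rule: induct_nat_012)
    case (ge2 m)
    have IH: "denom s (Suc m) = denom x (Suc m) + (s 1 - x 1) * numer x (Suc m)"
      "denom s (Suc (Suc m)) = denom x (Suc (Suc m)) + (s 1 - x 1) * numer x (Suc (Suc m))"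
      using ge2 by simp_all
    have "s (Suc (Suc m)) = x (Suc (Suc m))" using ge2.prems by simp
    then show ?case
      unfolding cont_rec.simps(3)[of _ _ _ "Suc m"] IH by (simp add: algebra_simps del: cont_rec.simps)
  qed simp_all
  from this[of "n - 1"] assms show ?thesis by simp
qed

lemma complete_seq_props:
  assumes "k \<ge> 1" "x \<in> coord_space k" "numer x (2*k) \<noteq> 0"
  defines "s \<equiv> complete_seq k x"
  shows "\<And>i. i \<in> {2..<2*k} \<Longrightarrow> s i = x i"
    and "numer s (2*k) = numer x (2*k)" "numer s (Suc (2*k)) = 0" "denom s (2*k) = 0"
proof -
  show s: "s i = x i" if "i \<in> {2..<2*k}" for i
    using that by (auto simp: s_def complete_seq_def)
  obtain m where m: "2*k = Suc (Suc m)" using assms(1)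
    by (metis Suc_eq_plus1 add_Suc_right mult_2 not0_implies_Suc not_one_le_zero)
  show n: "numer s (2*k) = numer x (2*k)"
    by (rule numer_cong) (use s in auto)
  have n': "numer s (2*k - 1) = numer x (2*k - 1)"
    by (rule numer_cong) (use s in auto)
  have "s (2*k) * numer x (2*k) + numer x (2*k - 1) = 0"
    using assms(3) by (simp add: s_def complete_seq_def)
  then show "numer s (Suc (2*k)) = 0"
    using n n' by (simp add: m)
  have "denom s (2*k) = denom x (2*k) + (s 1 - x 1) * numer x (2*k)"
    by (rule denom_shift) (use s assms(1) in auto)
  also have "x 1 = 0" using assms(2) by (simp add: coord_space_def)
  also have "s 1 = - denom x (2*k) / numer x (2*k)"
    using assms(1) by (simp add: s_def complete_seq_def)
  finally show "denom s (2*k) = 0" using assms(3) by simp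
qed

lemma complete_seq_unique:
  assumes "k \<ge> 1" "x \<in> coord_space k" "\<And>i. i \<in> {2..<2*k} \<Longrightarrow> s i = x i"
    and s: "numer s (2*k) \<noteq> 0" "numer s (Suc (2*k)) = 0" "denom s (2*k) = 0"
  shows "\<And>i. i \<in> {1..2*k} \<Longrightarrow> complete_seq k x i = s i"
proof -
  fix i assume i: "i \<in> {1..2*k}"
  obtain m where m: "2*k = Suc (Suc m)" using assms(1)
    by (metis Suc_eq_plus1 add_Suc_right mult_2 not0_implies_Suc not_one_le_zero)
  have n: "numer s (2*k) = numer x (2*k)"
    by (rule numer_cong) (use assms(3) in auto)
  have n': "numer s (2*k - 1) = numer x (2*k - 1)"
    by (rule numer_cong) (use assms(3) in auto)
  have "s (2*k) * numer x (2*k) + numer x (2*k - 1) = 0"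
    using s(2) n n' by (simp add: m)
  then have l: "s (2*k) = - numer x (2*k - 1) / numer x (2*k)"
    using s(1) n by (simp add: field_simps add_eq_0_iff)
  have "denom s (2*k) = denom x (2*k) + (s 1 - x 1) * numer x (2*k)"
    by (rule denom_shift) (use assms in auto)
  also have "x 1 = 0" using assms(2) by (simp add: coord_space_def)
  finally have f: "s 1 = - denom x (2*k) / numer x (2*k)"
    using s n by (simp add: field_simps add_eq_0_iff)
  show "complete_seq k x i = s i"
    using i l f assms(3)[of i] by (auto simp: complete_seq_def)
qed

lemma stokes_param_eq: "stokes_param k S = (\<lambda>i. if i \<in> {2..<2*k} then entries S i else 0)"
  by (auto simp: stokes_param_def entries_def)

lemma stokes_param_in_coord_space: "stokes_param k S \<in> coord_space k"
  by (auto simp: stokes_param_eq coord_space_def)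

lemma numer_stokes_param: "n \<le> 2*k \<Longrightarrow> numer (stokes_param k S) n = numer (entries S) n"
  by (rule numer_cong) (auto simp: stokes_param_eq)

lemma stokes_tuple_complete_seq:
  assumes "k \<ge> 1" "S \<in> stokes k" "numer (entries S) (2*k) \<noteq> 0"
    "numer (entries S) (Suc (2*k)) = 0" "denom (entries S) (2*k) = 0"
  shows "stokes_tuple k (complete_seq k (stokes_param k S)) = S"
proof -
  have "complete_seq k (stokes_param k S) i = entries S i" if "i \<in> {1..2*k}" for i
    by (rule complete_seq_unique[OF assms(1) stokes_param_in_coord_space _ assms(3-5) that])
      (simp add: stokes_param_eq)
  then show ?thesis
    using stokes_tuple_cong[of k _ "entries S"] stokes_tuple_entries[OF assms(2)] by metis
qed

lemma cont_rec_entries_stokes_tuple: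
  assumes "n \<le> Suc (2*k)"
  shows "cont_rec a b (entries (stokes_tuple k s)) n = cont_rec a b s n"
  by (rule cont_rec_cong) (use assms in \<open>auto intro!: entries_stokes_tuple\<close>)

lemma complete_stokes_tuple:
  assumes "k \<ge> 1" "x \<in> coord_space k" "numer x (2*k) \<noteq> 0"
  defines "S \<equiv> stokes_tuple k (complete_seq k x)"
  shows "S \<in> stokes k" "stokes_param k S = x"
    "numer (entries S) (2*k) = numer x (2*k)" "numer (entries S) (Suc (2*k)) = 0"
    "denom (entries S) (2*k) = 0"
proof -
  note c = complete_seq_props[OF assms(1-3)]
  show "S \<in> stokes k" by (simp add: S_def stokes_tuple_in_stokes)
  show "stokes_param k S = x"
    using assms(2) c(1)
    by (auto simp: stokes_param_eq S_def entries_stokes_tuple fun_eq_iff coord_space_def)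
  show "numer (entries S) (2*k) = numer x (2*k)" "numer (entries S) (Suc (2*k)) = 0"
    "denom (entries S) (2*k) = 0"
    using c(2-4) by (simp_all add: S_def cont_rec_entries_stokes_tuple del: cont_rec.simps)
qed

lemma regular_at_coordinate:
  assumes "X \<subseteq> coord_space k"
  shows "regular_at (coord_functions k) X (\<lambda>x. x i) p"
proof (cases "i \<in> {2..<2*k}")
  case True
  then show ?thesis
    by (intro regular_at_polynomial polynomial_functions.coord) (auto simp: coord_functions_def)
next
  case False
  then show ?thesis
    using assms by (intro regular_at_cong[OF _ regular_at_const[of _ _ 0]]) (auto simp: coord_space_def)
qed

lemma regular_at_cont_rec:
  assumes "X \<subseteq> coord_space k"
  shows "regular_at (coord_functions k) X (\<lambda>x. cont_rec a b x n) p"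
  by (induction n rule: induct_nat_012)
    (simp_all add: regular_at_const regular_at_add regular_at_mult regular_at_coordinate[OF assms])

lemma regular_at_complete_seq:
  assumes "X \<subseteq> coord_space k" "p \<in> X" "numer p (2*k) \<noteq> 0"
  shows "regular_at (coord_functions k) X (\<lambda>x. complete_seq k x i) p"
proof -
  \<comment> \<open>both outer coefficients are of this form\<close>
  have *: "regular_at (coord_functions k) X (\<lambda>x. - cont_rec a b x n / numer x (2*k)) p" for a b n
    using regular_at_mult[OF regular_at_diff[OF regular_at_const[of _ _ 0] regular_at_cont_rec[OF assms(1)]]
        regular_at_inverse[OF regular_at_cont_rec[OF assms(1)] assms(3,2)]]
    by (simp add: divide_inverse)
  show ?thesis
    using *[of 0 1] *[of 1 0] regular_at_coordinate[OF assms(1)]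
    by (cases "i = 1"; cases "i = 2*k") (auto simp: complete_seq_def)
qed

lemma regular_at_stokes_tuple:
  assumes "X \<subseteq> coord_space k" "p \<in> X" "numer p (2*k) \<noteq> 0" "i \<in> {1..2*k}"
  shows "regular_at (coord_functions k) X (\<lambda>x. stokes_tuple k (complete_seq k x) i $ a $ b) p"
  using exhaust_2[of a] exhaust_2[of b] assms(4)
  by (cases "odd i") (auto simp: stokes_tuple_def regular_at_const regular_at_complete_seq[OF assms(1-3)])

lemma regular_at_stokes_param:
  assumes "\<And>i a b. i \<in> {1..2*k} \<Longrightarrow> regular_at coords X (\<lambda>x. \<sigma> x i $ a $ b) p"
  shows "y \<in> coord_functions k \<Longrightarrow> regular_at coords X (\<lambda>x. y (stokes_param k (\<sigma> x))) p"
proof -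
  assume "y \<in> coord_functions k"
  then obtain i where i: "y = (\<lambda>x. x i)" "i \<in> {2..<2*k}" by (auto simp: coord_functions_def)
  then show ?thesis using assms[of i] by (cases "odd i") (simp_all add: stokes_param_def)
qed

lemma variety_iso_B_param:
  assumes "k \<ge> 1"
  shows "variety_iso (B_param k) (B_variety k) (euler_open_variety k)"
  unfolding B_variety_def euler_open_variety_def
proof (rule variety_iso_subvariety)
  let ?inv = "\<lambda>x. (stokes_tuple k (complete_seq k x), diag2 (inverse (numer x (2*k))) (numer x (2*k)))"
  note e = euler_eq_cont_rec[OF assms]
  show "B_param k p \<in> euler_open k" if "p \<in> Bspace k" for p
    using that by (cases p)
      (simp add: Bspace_iff B_param_def euler_open_def e stokes_param_in_coord_space numer_stokes_param)
  show "?inv (B_param k p) = p" if "p \<in> Bspace k" for p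
    using that by (cases p)
      (simp add: Bspace_iff B_param_def stokes_tuple_complete_seq[OF assms] numer_stokes_param
          del: cont_rec.simps)
  show "?inv x \<in> Bspace k" "B_param k (?inv x) = x" if "x \<in> euler_open k" for x
    using that complete_stokes_tuple[OF assms, of x]
    by (simp_all add: Bspace_iff euler_open_def e B_param_def del: cont_rec.simps)
  show "regular_at (B_coords k) (Bspace k) (\<lambda>p. y (B_param k p)) p" if "y \<in> coord_functions k" for y p
    unfolding B_param_def case_prod_unfold
  proof (rule regular_at_stokes_param[OF _ that])
    fix i a b assume "i \<in> {1..2*k}"
    then have "(\<lambda>(S, h). S i $ a $ b) \<in> B_coords k"
      unfolding B_coords_def stokes_coords_def
      by (intro UnI1 CollectI bexI[of _ "\<lambda>S. S i $ a $ b"]) blast+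
    then show "regular_at (B_coords k) (Bspace k) (\<lambda>p. fst p i $ a $ b) p"
      unfolding case_prod_unfold by (intro regular_at_polynomial polynomial_functions.coord)
  qed
  fix f p assume f: "f \<in> B_coords k" and p: "p \<in> euler_open k"
  have X: "euler_open k \<subseteq> coord_space k" "numer p (2*k) \<noteq> 0" using p by (auto simp: euler_open_def e)
  from f consider i a b where "f = (\<lambda>(S, h). S i $ a $ b)" "i \<in> {1..2*k}" | a b where "f
      = (\<lambda>(S, h). h $ a $ b)"
    unfolding B_coords_def stokes_coords_def by blast
  then show "regular_at (coord_functions k) (euler_open k) (\<lambda>x. f (?inv x)) p"
  proof cases
    case 1
    then show ?thesis by (simp only: case_prod_conv regular_at_stokes_tuple[OF X(1) p X(2)])
  next
    case 2
    then show ?thesis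
      using exhaust_2[of a] exhaust_2[of b] regular_at_inverse[OF regular_at_cont_rec[OF X(1)] X(2) p]
      by (auto simp: regular_at_const regular_at_cont_rec[OF X(1)])
  qed
qed

lemma variety_iso_stokes_fibre:
  assumes "k \<ge> 1" "q \<noteq> 0"
  shows "variety_iso (stokes_param k) (stokes_fibre k (diag2 (inverse q) q)) (euler_hypersurface k (1 / q))"
  unfolding stokes_fibre_def euler_hypersurface_def
proof (rule variety_iso_subvariety)
  let ?inv = "\<lambda>x. stokes_tuple k (complete_seq k x)"
  let ?X = "{S \<in> stokes k. stokes_prod S (2*k) = diag2 (inverse q) q}"
  let ?Y = "{x \<in> coord_space k. euler k x = 1 / q}"
  note e = euler_eq_cont_rec[OF assms(1)] and iff = stokes_prod_eq_diag2_iff[OF _ assms(2), of _ k]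
  show "stokes_param k S \<in> ?Y" if "S \<in> ?X" for S
    using that
    by (auto simp: iff e stokes_param_in_coord_space numer_stokes_param divide_inverse simp
        del: cont_rec.simps)
  show "?inv (stokes_param k S) = S" if "S \<in> ?X" for S
  proof -
    from that have S: "S \<in> stokes k" and P: "stokes_prod S (2*k) = diag2 (inverse q) q" by auto
    show ?thesis
      using iff[OF S, THEN iffD1, OF P] assms(2)
      by (intro stokes_tuple_complete_seq[OF assms(1) S]) auto
  qed
  show "?inv x \<in> ?X" "stokes_param k (?inv x) = x" if "x \<in> ?Y" for x
    using that complete_stokes_tuple[OF assms(1), of x] assms(2)
    by (simp_all add: iff e divide_inverse del: cont_rec.simps)
  show "regular_at (stokes_coords k) ?X (\<lambda>p. y (stokes_param k p)) p" if "y \<in> coord_functions k" for y p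
    by (rule regular_at_stokes_param[OF _ that])
      (unfold stokes_coords_def, intro regular_at_polynomial polynomial_functions.coord, blast)
  fix f p assume f: "f \<in> stokes_coords k" and p: "p \<in> ?Y"
  have X: "?Y \<subseteq> coord_space k" "numer p (2*k) \<noteq> 0" using p assms(2) by (auto simp: e)
  show "regular_at (coord_functions k) ?Y (\<lambda>x. f (?inv x)) p"
  proof -
    from f obtain i a b where "f = (\<lambda>S. S i $ a $ b)" "i \<in> {1..2*k}"
      unfolding stokes_coords_def by blast
    then show ?thesis by (simp only: regular_at_stokes_tuple[OF X(1) p X(2)])
  qed
qed

section \<open>The torus action\<close>

lemma torus_conj_nth:
  assumes "t \<in> torus"
  shows "torus_conj t S i $ a $ b = t$a$a * S i $ a $ b / t$b$b"
  using exhaust_2[of a] exhaust_2[of b] assms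
  by (auto simp: torus_conj_def matrix_inv_torus mat2_mult_nth torus_def divide_inverse)

lemma torus_conj_in_stokes:
  assumes "t \<in> torus" "S \<in> stokes k"
  shows "torus_conj t S \<in> stokes k"
proof -
  have "torus_conj t S i \<in> (if odd i then U_plus else U_minus)" if "i \<in> {1..2*k}" for i
    using stokes_nth[OF assms(2) that] assms(1)
    by (simp add: U_plus_def U_minus_def torus_conj_nth[OF assms(1)]) (simp add: torus_def)
  moreover have "torus_conj t S i = 0" if "i \<notin> {1..2*k}" for i
    using assms(2) that by (auto simp: stokes_def torus_conj_def)
  ultimately show ?thesis by (simp add: stokes_def)
qed

lemma entries_torus_conj:
  assumes "t \<in> torus"
  shows "entries (torus_conj t S) = scale_act (torus_char t) (entries S)"
  using assms by (auto simp: entries_def torus_conj_nth scale_act_def torus_char_def)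

lemma torus_char_nonzero: "t \<in> torus \<Longrightarrow> torus_char t \<noteq> 0"
  by (simp add: torus_def torus_char_def)

lemma torus_char_image: "torus_char ` torus = - {0}"
proof -
  have "c \<in> torus_char ` torus" if "c \<noteq> 0" for c
    by (rule image_eqI[of _ _ "diag2 c 1"]) (use that in \<open>simp_all add: torus_char_def torus_def\<close>)
  then show ?thesis by (auto simp: torus_char_nonzero)
qed

lemma stokes_param_torus_conj:
  assumes "t \<in> torus"
  shows "stokes_param k (torus_conj t S) = scale_act (torus_char t) (stokes_param k S)"
  by (auto simp: stokes_param_eq entries_torus_conj[OF assms] scale_act_def)

lemmas entries_weights = numer_weight[OF torus_char_nonzero] denom_weight[OF torus_char_nonzero]

lemma torus_act_Bspace:
  assumes "t \<in> torus" "p \<in> Bspace k"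
  shows "torus_act t p \<in> Bspace k"
  using assms by (cases p)
    (auto simp: torus_act_def Bspace_iff torus_conj_in_stokes entries_torus_conj entries_weights
      simp del: cont_rec.simps)

text \<open>The entries of \<open>P\<^sub>2\<^sub>k\<close> are semi-invariants, and the diagonal ones are invariant.\<close>

lemma torus_conj_fibre:
  assumes "t \<in> torus" "q \<noteq> 0" "S \<in> stokes k" "stokes_prod S (2*k) = diag2 (inverse q) q"
  shows "stokes_prod (torus_conj t S) (2*k) = diag2 (inverse q) q"
  using assms
  by (simp add: stokes_prod_eq_diag2_iff torus_conj_in_stokes entries_torus_conj entries_weights
      del: cont_rec.simps)

lemma wild_character_variety_iso:
  assumes "k \<ge> 1" "q \<noteq> 0"
  shows "variety_iso (fibre_quotient_map k q)
         (wild_character_variety k (diag2 (inverse q) q)) (euler_quotient k (1 / q))"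
  unfolding fibre_quotient_map_def wild_character_variety_def euler_quotient_def
proof (rule variety_iso_affine_quotient[where \<pi> = torus_char])
  show "variety_iso (stokes_param k) (stokes_fibre k (diag2 (inverse q) q)) (euler_hypersurface k (1 / q))"
    by (rule variety_iso_stokes_fibre[OF assms])
  show "torus_conj t S \<in> fst (stokes_fibre k (diag2 (inverse q) q))"
    if "t \<in> torus" "S \<in> fst (stokes_fibre k (diag2 (inverse q) q))" for t S
    using that assms(2)
    by (simp add: stokes_fibre_def subvariety_def torus_conj_in_stokes torus_conj_fibre)
  show "(\<lambda>x.
      if x \<in> fst (euler_hypersurface k (1 / q)) then c else 0) \<in> snd (euler_hypersurface k (1 / q))" for c
    unfolding euler_hypersurface_def subvariety_def fst_conv snd_conv by (rule regular_functions_ring)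
qed (simp_all add: euler_hypersurface_def subvariety_def regular_functions_ring torus_char_image
    stokes_param_torus_conj, simp add: regular_functions_iff)

section \<open>The symplectic form and its moment map\<close>

text \<open>The symplectic form on the open set where the continuant is nonzero.\<close>

definition euler_form :: "nat \<Rightarrow> complex \<Rightarrow> cform" where
  "euler_form k a x v w = a * alt_hess x v w (2*k) / numer x (2*k)"

lemma regular_at_cont_rec_diff:
  assumes "X \<subseteq> coord_space k"
  shows "regular_at (coord_functions k) X (\<lambda>x. cont_rec_diff a b x v n) p"
  by (induction n rule: induct_nat_012)
    (simp_all add: regular_at_const regular_at_add regular_at_mult regular_at_coordinate[OF assms]
      regular_at_cont_rec[OF assms])

lemma regular_at_alt_hess:
  assumes "X \<subseteq> coord_space k"
  shows "regular_at (coord_functions k) X (\<lambda>x. alt_hess x v w n) p"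
  by (induction n rule: induct_nat_012)
    (simp_all add: regular_at_const regular_at_add regular_at_diff regular_at_mult
      regular_at_coordinate[OF assms] regular_at_cont_rec_diff[OF assms])

lemma euler_form_regular:
  assumes "k \<ge> 1"
  shows "(\<lambda>x. if x \<in> euler_open k then euler_form k a x v w else 0)
    \<in> regular_functions (coord_functions k) (euler_open k)"
  unfolding regular_functions_iff
proof (intro conjI allI impI ballI)
  fix p assume p: "p \<in> euler_open k"
  have U: "euler_open k \<subseteq> coord_space k" "numer p (2*k) \<noteq> 0"
    using p by (auto simp: euler_open_def euler_eq_cont_rec[OF assms])
  have "regular_at (coord_functions k) (euler_open k)
      (\<lambda>x. a * alt_hess x v w (2*k) * inverse (numer x (2*k))) p"
    by (intro regular_at_mult regular_at_inverse regular_at_const regular_at_alt_hess[OF U(1)]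
        regular_at_cont_rec[OF U(1)] U p)
  then show "regular_at (coord_functions k) (euler_open k)
      (\<lambda>x. if x \<in> euler_open k then euler_form k a x v w else 0) p"
    by (rule regular_at_cong[rotated]) (simp add: euler_form_def divide_inverse)
qed simp

lemma dir_deriv_euler:
  "k \<ge> 1 \<Longrightarrow> dir_deriv (euler k) x v = dnumer x v (2*k)"
  using has_derivative_cont_rec[of 1 0 x v "2*k" 0]
  by (simp add: dir_deriv_def euler_eq_cont_rec DERIV_imp_deriv)

lemma dir_deriv_euler_form:
  assumes "numer x (2*k) \<noteq> 0"
  shows "dir_deriv (\<lambda>y. euler_form k a y v w) x u
    = a * (alt_hess_diff x u v w (2*k) * numer x (2*k) - alt_hess x v w (2*k) * dnumer x u (2*k))
        / (numer x (2*k))\<^sup>2"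
  unfolding dir_deriv_def euler_form_def
  by (rule DERIV_imp_deriv)
    (rule derivative_eq_intros has_derivative_alt_hess has_derivative_cont_rec refl
      | use assms in \<open>simp add: power2_eq_square right_diff_distrib\<close>)+

lemma generating_field_scale_act: "generating_field scale_act x = weight_field x"
proof
  fix i
  have "deriv (\<lambda>c. scale_act c x i) 1 = weight_field x i"
  proof (cases "odd i")
    case True
    have "((\<lambda>c. c * x i) has_field_derivative x i) (at 1)"
      by (auto intro!: derivative_eq_intros)
    then show ?thesis using True by (simp add: scale_act_def weight_field_def DERIV_imp_deriv)
  next
    case False
    have "((\<lambda>c. inverse c * x i) has_field_derivative - x i) (at 1)"
      by (auto intro!: derivative_eq_intros)
    then show ?thesis using False by (simp add: scale_act_def weight_field_def DERIV_imp_deriv)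
  qed
  then show "generating_field scale_act x i = weight_field x i" by (simp add: generating_field_def)
qed

text \<open>Everything reduces to properties of the numerator \<open>\<alpha>\<close>: by the quotient rule the exterior derivative
  of \<open>\<alpha> / K\<close> is \<open>(K d\<alpha> - dK \<and> \<alpha>) / K\<^sup>2\<close>, and nondegeneracy is insensitive to the factor \<open>1 / K\<close>.\<close>

lemma symplectic_euler_form:
  assumes "k \<ge> 1" "a \<noteq> 0"
  shows "symplectic_form k (euler_open k) (euler_form k a)"
  unfolding symplectic_form_def
proof (intro conjI ballI allI impI)
  fix x u v w assume "x \<in> euler_open k"
  then have x: "numer x (2*k) \<noteq> 0" by (simp add: euler_open_def euler_eq_cont_rec[OF assms(1)])
  have "numer x (2*k) * alt_third x u v w (2*k) = cyc_wedge x u v w (2*k) (2*k)"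
    using alt_hess_closed by blast
  then show "dir_deriv (\<lambda>y. euler_form k a y v w) x u + dir_deriv (\<lambda>y. euler_form k a y w u) x v
      + dir_deriv (\<lambda>y. euler_form k a y u v) x w = 0"
    unfolding dir_deriv_euler_form[OF x] alt_third_def cyc_wedge_def
    by (simp flip: add_divide_distrib distrib_left add: x assms) (simp add: algebra_simps)
next
  fix x v assume x: "x \<in> euler_open k" and v: "v \<in> coord_space k"
    and null: "\<forall>w\<in>coord_space k. euler_form k a x v w = 0"
  have e: "numer x (2*k) \<noteq> 0" using x by (simp add: euler_open_def euler_eq_cont_rec[OF assms(1)])
  have "alt_hess x v w (2*k) = 0" for w
  proof -
    \<comment> \<open>only the entries of \<open>w\<close> with index between \<open>2\<close> and \<open>2*k - 1\<close> matter\<close>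
    have "alt_hess x v w (2*k) = alt_hess x v (\<lambda>i. if i \<in> {2..<2*k} then w i else 0) (2*k)"
      by (rule alt_hess_cong) auto
    then show ?thesis
      using null[rule_format, of "\<lambda>i. if i \<in> {2..<2*k} then w i else 0"] e assms(2)
      by (simp add: euler_form_def coord_space_def)
  qed
  then have "v i = 0" if "2 \<le> i" "i < 2*k" for i
    using alt_hess_nondegenerate[OF e _ that, of v] by simp
  then show "v = (\<lambda>_. 0)" using v by (auto simp: coord_space_def fun_eq_iff)
next
  fix v w
  show "(\<lambda>x. if x \<in> euler_open k then euler_form k a x v w else 0)
      \<in> regular_functions (coord_functions k) (euler_open k)"
    by (rule euler_form_regular[OF assms(1)])
next
  fix x v w
  show "euler_form k a x v w = - euler_form k a x w v"
    using alt_hess_swap[of x v w] by (simp add: euler_form_def)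
qed (simp_all add: euler_form_def alt_hess_add alt_hess_scale algebra_simps add_divide_distrib)

lemma moment_map_euler:
  assumes "k \<ge> 1" "a \<noteq> 0"
  shows "group_valued_moment_map k (euler_open k) scale_act (euler_form k a) (- a) (euler k)"
  unfolding group_valued_moment_map_def
proof (intro conjI allI impI ballI)
  show "symplectic_form k (euler_open k) (euler_form k a)" by (rule symplectic_euler_form[OF assms])
  show "scale_act c x \<in> euler_open k" "euler k (scale_act c x) = euler k x"
    if "c \<noteq> 0 \<and> x \<in> euler_open k" for c x
    using that numer_weight[of c x "2*k"]
    by (auto simp: euler_open_def euler_eq_cont_rec[OF assms(1)] coord_space_def scale_act_def)
  show "euler_form k a x (generating_field scale_act x) w
      = - a * (dir_deriv (euler k) x w / euler k x)" for x w
    by (simp add: euler_form_def generating_field_scale_act alt_hess_weight dir_deriv_euler[OF assms(1)]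
        euler_eq_cont_rec[OF assms(1)])
qed (simp add: euler_open_def)

section \<open>Invariant bilinear forms\<close>

definition unit_up :: mat2 where "unit_up = vector [vector [0, 1], vector [0, 0]]"

definition unit_low :: mat2 where "unit_low = vector [vector [0, 0], vector [1, 0]]"

lemma unit_nth [simp]:
  "unit_up $ 1 $ 1 = 0" "unit_up $ 1 $ 2 = 1" "unit_up $ 2 $ 1 = 0" "unit_up $ 2 $ 2 = 0"
  "unit_low $ 1 $ 1 = 0" "unit_low $ 1 $ 2 = 0" "unit_low $ 2 $ 1 = 1" "unit_low $ 2 $ 2 = 0"
  by (simp_all add: unit_up_def unit_low_def)

lemma smat_nth [simp]: "smat c X $ i $ j = c * X $ i $ j"
  by (simp add: smat_def)

context
  fixes \<beta> :: "mat2 \<Rightarrow> mat2 \<Rightarrow> complex"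
  assumes \<beta>: "invariant_form \<beta>"
begin

lemma form_linear:
  "\<beta> (X + Y) Z = \<beta> X Z + \<beta> Y Z" "\<beta> Z (X + Y) = \<beta> Z X + \<beta> Z Y"
  "\<beta> (smat c X) Y = c * \<beta> X Y" "\<beta> X (smat c Y) = c * \<beta> X Y"
  using \<beta> unfolding invariant_form_def by metis+

lemma form_sym: "\<beta> X Y = \<beta> Y X"
  using \<beta> unfolding invariant_form_def by blast

lemma form_zero: "\<beta> 0 Y = 0" "\<beta> Y 0 = 0"
  using form_linear(1)[of 0 0 Y] form_linear(2)[of Y 0 0] by auto

lemma form_minus: "\<beta> (- X) Y = - \<beta> X Y" "\<beta> Y (- X) = - \<beta> Y X"
  using form_linear(1)[of X "- X" Y] form_linear(2)[of Y X "- X"] form_zero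
  by (simp_all add: eq_neg_iff_add_eq_0 add.commute)

lemma form_conj:
  assumes "A ** B = mat 1"
  shows "\<beta> (A ** X ** B) (A ** Y ** B) = \<beta> X Y"
proof -
  have "invertible A" "matrix_inv A = B"
    using assms invertible_right_inverse matrix_inv_eqI by blast+
  then show ?thesis using \<beta> unfolding invariant_form_def by metis
qed

text \<open>Conjugation by a diagonal matrix acts on the elementary matrices by the weights \<open>2\<close>, \<open>1/2\<close> and
  \<open>1\<close>; only elements of inverse weights can have a nonzero pairing.\<close>

lemma form_diag_conj:
  "\<beta> X Y = \<beta> (diag2 2 1 ** X ** diag2 (1/2) 1) (diag2 2 1 ** Y ** diag2 (1/2) 1)"
  by (rule form_conj[symmetric]) (simp add: mat2_eq_iff mat2_mult_nth mat2_one_nth)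

text \<open>The normalisation constant of the bilinear form.\<close>

definition pairing where "pairing = \<beta> unit_up unit_low"

lemma form_unit:
  "\<beta> unit_up Y = pairing * Y$2$1" "\<beta> unit_low Y = pairing * Y$1$2"
proof -
  have c: "diag2 2 1 ** unit_up ** diag2 (1/2) 1 = smat 2 unit_up"
    "diag2 2 1 ** unit_low ** diag2 (1/2) 1 = smat (1/2) unit_low"
    "diag2 2 1 ** diag2 x y ** diag2 (1/2) 1 = diag2 x y" for x y
    by (simp_all add: mat2_eq_iff mat2_mult_nth)
  have Y: "Y = diag2 (Y$1$1) (Y$2$2) + smat (Y$1$2) unit_up + smat (Y$2$1) unit_low"
    by (simp add: mat2_eq_iff)
  have uu: "\<beta> unit_up unit_up = 0" and ll: "\<beta> unit_low unit_low = 0"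
    using form_diag_conj[of unit_up unit_up] form_diag_conj[of unit_low unit_low]
    by (simp_all add: c form_linear)
  have ud: "\<beta> unit_up (diag2 x y) = 0" "\<beta> unit_low (diag2 x y) = 0" for x y
    using form_diag_conj[of unit_up "diag2 x y"] form_diag_conj[of unit_low "diag2 x y"]
    by (simp_all add: c form_linear)
  show "\<beta> unit_up Y = pairing * Y$2$1"
    by (subst Y) (simp add: form_linear uu ud pairing_def)
  show "\<beta> unit_low Y = pairing * Y$1$2"
    by (subst Y) (simp add: form_linear ll ud pairing_def form_sym[of unit_low unit_up])
qed

lemma pairing_nonzero: "pairing \<noteq> 0"
proof
  assume "pairing = 0"
  then have "unit_up = 0" using \<beta> form_unit(1) unfolding invariant_form_def by auto
  then show False using unit_nth(2) by simp
qed

end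

section \<open>Differentials along affine lines\<close>

definition curve_deriv :: "(complex \<Rightarrow> mat2) \<Rightarrow> mat2 \<Rightarrow> bool" where
  "curve_deriv M D \<longleftrightarrow> (\<forall>i j. ((\<lambda>z. M z $ i $ j) has_field_derivative D $ i $ j) (at 0))"

lemma curve_deriv_line: "curve_deriv (\<lambda>z. A + smat z B) B"
  by (auto simp: curve_deriv_def intro!: derivative_eq_intros)

lemma curve_deriv_const: "curve_deriv (\<lambda>z. A) 0"
  by (simp add: curve_deriv_def)

lemma curve_deriv_mult:
  assumes "curve_deriv M D" "curve_deriv N E"
  shows "curve_deriv (\<lambda>z. M z ** N z) (D ** N 0 + M 0 ** E)"
  using assms unfolding curve_deriv_def
  by (auto simp: mat2_mult_nth intro!: derivative_eq_intros)

lemma curve_deriv_unique: "\<lbrakk>curve_deriv M D; curve_deriv M E\<rbrakk> \<Longrightarrow> D = E"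
  unfolding curve_deriv_def vec_eq_iff by (blast intro: DERIV_unique)

lemma curve_deriv_cong:
  assumes "\<forall>\<^sub>F z in nhds 0. M z = N z" "curve_deriv M D"
  shows "curve_deriv N D"
  unfolding curve_deriv_def
proof (intro allI)
  fix i j
  have "\<forall>\<^sub>F z in nhds 0. M z $ i $ j = N z $ i $ j"
    using assms(1) by eventually_elim simp
  then show "((\<lambda>z. N z $ i $ j) has_field_derivative D $ i $ j) (at 0)"
    using assms(2) DERIV_cong_ev[of 0 0 "\<lambda>z. M z $ i $ j" "\<lambda>z. N z $ i $ j"]
    unfolding curve_deriv_def by blast
qed

lemma A_diff_eqI: "curve_deriv (\<lambda>z. F (A_line p v z)) D \<Longrightarrow> A_diff F p v = D"
  by (auto simp: A_diff_def curve_deriv_def vec_eq_iff DERIV_imp_deriv)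

lemma invertible_iff_minor:
  "invertible A \<longleftrightarrow> A$1$1 * A$2$2 - A$1$2 * A$2$1 \<noteq> 0" for A :: mat2
  by (simp add: invertible_det_nz det_2)

lemma matrix_inv_mat2:
  fixes A :: mat2
  assumes "A$1$1 * A$2$2 - A$1$2 * A$2$1 \<noteq> 0"
  shows "matrix_inv A = smat (inverse (A$1$1 * A$2$2 - A$1$2 * A$2$1))
    (vector [vector [A$2$2, - A$1$2], vector [- A$2$1, A$1$1]])"
proof (rule matrix_inv_eqI)
  define d where "d = A$1$1 * A$2$2 - A$1$2 * A$2$1"
  have "inverse d * d = 1" using assms by (simp add: d_def)
  then have d: "inverse d * (A$1$1 * A$2$2) = 1 + inverse d * (A$1$2 * A$2$1)"
    by (subst (asm) (2) d_def) (simp add: right_diff_distrib diff_eq_eq)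
  show "A ** smat (inverse (A$1$1 * A$2$2 - A$1$2 * A$2$1))
    (vector [vector [A$2$2, - A$1$2], vector [- A$2$1, A$1$1]]) = mat 1"
    unfolding d_def[symmetric]
    using d by (simp add: mat2_eq_iff mat2_mult_nth mat2_one_nth algebra_simps)
qed

lemma matrix_inv_mult: "invertible A \<Longrightarrow> matrix_inv A ** A = mat 1 \<and> A ** matrix_inv A = mat 1" for A :: mat2
  by (metis invertible_def matrix_inv_eqI)

text \<open>The entries of the inverse are rational functions of the entries of the matrix, with the determinant
  as denominator.\<close>

lemma curve_deriv_invertible:
  assumes "curve_deriv M D" "invertible (M 0)"
  shows "\<forall>\<^sub>F z in nhds 0. invertible (M z)"
    and "\<exists>E. curve_deriv (\<lambda>z. matrix_inv (M z)) E"
proof -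
  let ?d = "\<lambda>z. M z$1$1 * M z$2$2 - M z$1$2 * M z$2$1"
  have M: "((\<lambda>z. M z $ i $ j) has_field_derivative D $ i $ j) (at 0)" for i j
    using assms(1) by (simp add: curve_deriv_def)
  have "isCont ?d 0"
    by (intro isCont_diff isCont_mult M[THEN DERIV_isCont])
  then have "(?d \<longlongrightarrow> ?d 0) (nhds 0)"
    unfolding isCont_def by (rule tendsto_at_iff_tendsto_nhds[THEN iffD1])
  moreover have "?d 0 \<noteq> 0" using assms(2) by (simp add: invertible_iff_minor)
  ultimately have ev: "\<forall>\<^sub>F z in nhds 0. ?d z \<noteq> 0" by (rule tendsto_imp_eventually_ne)
  then show "\<forall>\<^sub>F z in nhds 0. invertible (M z)" by (simp add: invertible_iff_minor)
  let ?N = "\<lambda>z. smat (inverse (?d z)) (vector [vector [M z$2$2, - M z$1$2], vector [- M z$2$1, M z$1$1]])"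
  have "(\<lambda>z. ?N z $ i $ j) field_differentiable at 0" for i j
  proof -
    have "(\<lambda>z. inverse (?d z) * M z $ a $ b) field_differentiable at 0"
      "(\<lambda>z. inverse (?d z) * - M z $ a $ b) field_differentiable at 0" for a b
      using M assms(2) unfolding invertible_iff_minor
      by (intro field_differentiable_mult field_differentiable_inverse field_differentiable_diff
          field_differentiable_minus; auto simp: field_differentiable_def)+
    then show ?thesis
      using exhaust_2[of i] exhaust_2[of j] by auto
  qed
  then have N: "curve_deriv ?N (\<chi> i j. deriv (\<lambda>z. ?N z $ i $ j) 0)"
    unfolding curve_deriv_def vec_lambda_beta DERIV_deriv_iff_field_differentiable by blast
  have "\<forall>\<^sub>F z in nhds 0. ?N z = matrix_inv (M z)"
    using ev by eventually_elim (simp add: matrix_inv_mat2)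
  from curve_deriv_cong[OF this N] show "\<exists>E. curve_deriv (\<lambda>z. matrix_inv (M z)) E" ..
qed

primrec stokes_prod_diff :: "(nat \<Rightarrow> mat2) \<Rightarrow> (nat \<Rightarrow> mat2) \<Rightarrow> nat \<Rightarrow> mat2" where
  "stokes_prod_diff S V 0 = 0"
| "stokes_prod_diff S V (Suc n) = V (Suc n) ** stokes_prod S n + S (Suc n) ** stokes_prod_diff S V n"

lemma curve_deriv_stokes_prod:
  "curve_deriv (\<lambda>z. stokes_prod (\<lambda>i. S i + smat z (V i)) n) (stokes_prod_diff S V n)"
proof (induction n)
  case (Suc n)
  have "smat 0 X = 0" for X by (simp add: mat2_eq_iff)
  then show ?case
    using curve_deriv_mult[OF curve_deriv_line Suc, of "S (Suc n)" "V (Suc n)"] by simp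
qed (simp add: curve_deriv_const)

lemma stokes_tangent_nth:
  assumes "V \<in> stokes_tangent k" "i \<in> {1..2*k}"
  shows "V i $1$1 = 0" "V i $2$2 = 0"
    "V i $1$2 = (if odd i then entries V i else 0)" "V i $2$1 = (if odd i then 0 else entries V i)"
proof -
  have "V i $1$1 = 0 \<and> V i $2$2 = 0 \<and> (if odd i then V i $2$1 = 0 else V i $1$2 = 0)"
    using assms unfolding stokes_tangent_def by blast
  then show "V i $1$1 = 0" "V i $2$2 = 0" "V i $1$2 = (if odd i then entries V i else 0)"
    "V i $2$1 = (if odd i then 0 else entries V i)"
    by (auto simp: entries_def split: if_splits)
qed

lemma stokes_prod_diff_eq:
  assumes S: "S \<in> stokes k" and V: "V \<in> stokes_tangent k" and "n \<le> 2 * k"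
  defines "s \<equiv> entries S" and "v \<equiv> entries V"
  shows "stokes_prod_diff S V n = (if even n
     then vector [vector [dnumer s v n, ddenom s v n], vector [dnumer s v (Suc n), ddenom s v (Suc n)]]
     else vector [vector [dnumer s v (Suc n), ddenom s v (Suc n)], vector [dnumer s v n, ddenom s v n]])"
  using assms(3)
proof (induction n)
  case (Suc n)
  then show ?case
    using stokes_nth[OF S, of "Suc n"] stokes_tangent_nth[OF V, of "Suc n"]
    by (simp add: mat2_eq_iff mat2_mult_nth stokes_prod_eq[OF S] continuant_matrix_def
        flip: s_def v_def)
qed (simp add: mat2_eq_iff)

section \<open>The level set of the moment map\<close>

lemma A_diff_C_map:
  "A_diff (C_map n) (C, S, h) (X, V, Y) = stokes_prod_diff S V n ** C + stokes_prod S n ** X"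
proof (rule A_diff_eqI)
  have z: "smat 0 X = 0" for X by (simp add: mat2_eq_iff)
  show "curve_deriv (\<lambda>z. C_map n (A_line (C, S, h) (X, V, Y) z))
      (stokes_prod_diff S V n ** C + stokes_prod S n ** X)"
    using curve_deriv_mult[OF curve_deriv_stokes_prod[of S V n] curve_deriv_line[of C X]]
    by (simp add: C_map_def A_line_def z)
qed

lemma curve_deriv_b_map:
  "curve_deriv (\<lambda>z. b_map k (A_line (C, S, h) (X, V, Y) z))
     (Y ** stokes_prod S (2*k) + h ** stokes_prod_diff S V (2*k))"
proof -
  have z: "smat 0 X = 0" for X by (simp add: mat2_eq_iff)
  show ?thesis
    using curve_deriv_mult[OF curve_deriv_line[of h Y] curve_deriv_stokes_prod[of S V "2*k"]]
    by (simp add: b_map_def A_line_def z)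
qed

lemma level_set_iff:
  "(C, S, h) \<in> level_set k \<longleftrightarrow> invertible C \<and> (S, h) \<in> Bspace k"
proof -
  have "matrix_inv C ** h ** P ** C = mat 1 \<longleftrightarrow> h ** P = mat 1" if "invertible C" for P
  proof -
    have C: "matrix_inv C ** C = mat 1" "C ** matrix_inv C = mat 1"
      using matrix_inv_mult[OF that] by auto
    have "h ** P = C ** (matrix_inv C ** h ** P ** C) ** matrix_inv C"
      using C by (simp add: matrix_mul_assoc) (simp add: C flip: matrix_mul_assoc)
    moreover have "matrix_inv C ** h ** P ** C = matrix_inv C ** (h ** P) ** C"
      by (simp add: matrix_mul_assoc)
    ultimately show ?thesis using C by auto
  qed
  then show ?thesis
    by (auto simp: level_set_def Aspace_def Bspace_def moment_G_def)
qed

text \<open>Let \<open>\<mu>\<close> be the moment map and \<open>b = hP\<close>. Differentiating \<open>C \<mu> = b C\<close> at a point with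
  \<open>\<mu> = b = 1\<close> in a direction with \<open>d\<mu> = 0\<close> leaves \<open>db C = 0\<close>. In this form only the differentiability of the
  matrix inverse enters, not its derivative.\<close>

lemma level_tangent_b:
  assumes "(C, S, h) \<in> level_set k" "(X, V, Y) \<in> level_tangent k (C, S, h)"
  shows "Y ** stokes_prod S (2*k) + h ** stokes_prod_diff S V (2*k) = 0"
proof -
  let ?L = "A_line (C, S, h) (X, V, Y)"
  let ?P = "stokes_prod S (2*k)" and ?D = "stokes_prod_diff S V (2*k)"
  define db where "db = Y ** ?P + h ** ?D"
  have C: "invertible C" and b: "h ** ?P = mat 1"
    using assms(1) by (auto simp: level_set_iff Bspace_def)
  have z: "smat 0 X = 0" for X by (simp add: mat2_eq_iff)
  have L0: "?L 0 = (C, S, h)" by (simp add: A_line_def z)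
  have bd: "curve_deriv (\<lambda>z. b_map k (?L z)) db" by (simp add: db_def curve_deriv_b_map)
  have Cd: "curve_deriv (\<lambda>z. C + smat z X) X" by (rule curve_deriv_line)
  have inv0: "invertible (C + smat 0 X)" using C by (simp add: z)
  obtain E where E: "curve_deriv (\<lambda>z. matrix_inv (C + smat z X)) E"
    using curve_deriv_invertible(2)[OF Cd inv0] by blast
  have mG: "moment_G k (?L z) = matrix_inv (C + smat z X) ** b_map k (?L z) ** (C + smat z X)" for z
    by (simp add: moment_G_def b_map_def A_line_def matrix_mul_assoc)
  obtain F where F: "curve_deriv (\<lambda>z. moment_G k (?L z)) F"
    unfolding mG using curve_deriv_mult[OF curve_deriv_mult[OF E bd] Cd] by blast
  moreover have "A_diff (moment_G k) (C, S, h) (X, V, Y) = 0"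
    using assms(2) by (simp add: level_tangent_def)
  ultimately have F0: "F = 0" using A_diff_eqI by metis
  have m0: "moment_G k (?L 0) = mat 1" using assms(1) by (simp add: L0 level_set_def)
  have b0: "b_map k (?L 0) = mat 1" by (simp add: L0 b_map_def b)
  have lhs: "curve_deriv (\<lambda>z. (C + smat z X) ** moment_G k (?L z)) X"
    using curve_deriv_mult[OF Cd F] by (simp add: F0 m0)
  have "\<forall>\<^sub>F z in nhds 0. (C + smat z X) ** moment_G k (?L z) = b_map k (?L z) ** (C + smat z X)"
    using curve_deriv_invertible(1)[OF Cd inv0]
    by eventually_elim (simp add: mG matrix_mul_assoc matrix_inv_mult)
  from curve_deriv_cong[OF this lhs]
  have "curve_deriv (\<lambda>z. b_map k (?L z) ** (C + smat z X)) X" .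
  moreover have "curve_deriv (\<lambda>z. b_map k (?L z) ** (C + smat z X)) (db ** C + X)"
    using curve_deriv_mult[OF bd Cd] by (simp add: b0 z)
  ultimately have "db ** C = 0" using curve_deriv_unique by fastforce
  then have "db ** (C ** matrix_inv C) = 0" by (simp add: matrix_mul_assoc)
  then show ?thesis using matrix_inv_mult[OF C] by (simp add: db_def)
qed

section \<open>The reduced two-form\<close>

text \<open>A tangent vector to a unipotent factor is a multiple of an elementary matrix, which pairs only with
  the opposite off-diagonal entry. As \<open>P\<^sub>n\<close> has determinant one, its inverse is its adjugate.\<close>

lemma pairing_stokes_increment:
  assumes "invariant_form \<beta>" "S \<in> stokes k" "V \<in> stokes_tangent k" "W \<in> stokes_tangent k" "Suc n \<le> 2*k"
  shows "\<beta> (V (Suc n)) (stokes_prod_diff S W n ** matrix_inv (stokes_prod S n))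
    = pairing \<beta> * ((-1) ^ n * (entries V (Suc n) * log_deriv_entry (entries S) (entries W) (Suc n)))"
proof -
  let ?e = "numer (entries S) n" and ?e' = "numer (entries S) (Suc n)"
    and ?g = "denom (entries S) n" and ?g' = "denom (entries S) (Suc n)"
  have w: "?e' * ?g - ?e * ?g' = - ((-1) ^ n)" by (rule wronskian)
  have inv: "matrix_inv (stokes_prod S n) = (if even n
      then vector [vector [?g', - ?g], vector [- ?e', ?e]]
      else vector [vector [?g, - ?g'], vector [- ?e, ?e']])"
    by (rule matrix_inv_eqI)
      (use w assms(5) in \<open>auto simp: stokes_prod_eq[OF assms(2)] continuant_matrix_def mat2_eq_iff
        mat2_mult_nth mat2_one_nth algebra_simps simp del: cont_rec.simps\<close>)
  have "V (Suc n) = smat (entries V (Suc n)) (if even n then unit_up else unit_low)"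
    using stokes_tangent_nth[OF assms(3), of "Suc n"] assms(5) by (simp add: mat2_eq_iff)
  then show ?thesis
    using assms(5)
    by (simp add: form_linear[OF assms(1)] form_unit[OF assms(1)] inv
        stokes_prod_diff_eq[OF assms(2,4)] mat2_mult_nth log_deriv_entry_def
        algebra_simps del: cont_rec.simps cont_rec_diff.simps)
qed

lemma stokes_prod_invertible:
  assumes "S \<in> stokes k" "n \<le> 2*k"
  shows "invertible (stokes_prod S n)"
  using wronskian[of "entries S" n]
  by (simp add: stokes_prod_eq[OF assms] invertible_iff_minor continuant_matrix_def algebra_simps
      del: cont_rec.simps)
    (auto simp: algebra_simps simp del: cont_rec.simps)

text \<open>The term \<open>S\<^sub>n\<^sub>+\<^sub>1\<^sup>-\<^sup>1 dS\<^sub>n\<^sub>+\<^sub>1\<close> equals \<open>dS\<^sub>n\<^sub>+\<^sub>1\<close> since the nilpotent part of \<open>S\<^sub>n\<^sub>+\<^sub>1\<close> annihilates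
  it.\<close>

lemma log_derivative_step:
  assumes "S \<in> stokes k" "V \<in> stokes_tangent k" "Suc n \<le> 2*k"
  defines "P \<equiv> stokes_prod S" and "D \<equiv> stokes_prod_diff S V"
  shows "matrix_inv (P (Suc n)) ** D (Suc n)
    = matrix_inv (P n) ** V (Suc n) ** P n + matrix_inv (P n) ** D n"
proof -
  have P: "invertible (P n)" "invertible (P (Suc n))"
    using stokes_prod_invertible[OF assms(1)] assms(3) by (auto simp: P_def simp del: stokes_prod.simps)
  have SV: "S (Suc n) ** V (Suc n) = V (Suc n)"
    using stokes_nth[OF assms(1), of "Suc n"] stokes_tangent_nth[OF assms(2), of "Suc n"] assms(3)
    by (simp add: mat2_eq_iff mat2_mult_nth)
  have "P (Suc n) ** (matrix_inv (P n) ** V (Suc n) ** P n + matrix_inv (P n) ** D n)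
     = S (Suc n) ** (P n ** matrix_inv (P n)) ** V (Suc n) ** P n
         + S (Suc n) ** (P n ** matrix_inv (P n)) ** D n"
    by (simp add: P_def matrix_add_ldistrib matrix_mul_assoc)
  also have "\<dots> = D (Suc n)"
    using matrix_inv_mult[OF P(1)] SV by (simp add: D_def P_def)
  finally have "matrix_inv (P (Suc n)) ** P (Suc n) ** (matrix_inv (P n) ** V (Suc n) ** P n
      + matrix_inv (P n) ** D n)
    = matrix_inv (P (Suc n)) ** D (Suc n)"
    by (simp flip: matrix_mul_assoc)
  then show ?thesis using matrix_inv_mult[OF P(2)] by simp
qed

text \<open>By \<open>log_derivative_step\<close> the difference \<open>p\<^sub>n\<^sub>+\<^sub>1 - p\<^sub>n\<close> is conjugate to \<open>dS\<^sub>n\<^sub>+\<^sub>1\<close>, and \<open>p\<^sub>n\<close> paired with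
  itself vanishes by antisymmetry. Conjugation by \<open>P\<^sub>n\<close> turns the other argument
  \<open>P\<^sub>n\<^sup>-\<^sup>1 dP\<^sub>n\<close> into \<open>dP\<^sub>n P\<^sub>n\<^sup>-\<^sup>1\<close>.\<close>

lemma fusion_sum_pairing:
  assumes \<beta>: "invariant_form \<beta>" and S: "S \<in> stokes k"
    and V: "V \<in> stokes_tangent k" and W: "W \<in> stokes_tangent k" and "n \<le> 2*k"
  defines "p \<equiv> \<lambda>U i. matrix_inv (stokes_prod S i) ** stokes_prod_diff S U i"
  shows "(\<Sum>i = 1..n. \<beta> (p V i) (p W (i - 1)) - \<beta> (p W i) (p V (i - 1)))
    = pairing \<beta> * fusion_sum (entries S) (entries V) (entries W) n"
  using assms(5)
proof (induction n)
  case (Suc n)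
  let ?P = "stokes_prod S n"
  have P: "invertible ?P" using stokes_prod_invertible[OF S] Suc.prems by simp
  note inv = matrix_inv_mult[OF P]
  have *: "\<beta> (matrix_inv ?P ** U ** ?P) (p U' n) = \<beta> U (stokes_prod_diff S U' n ** matrix_inv ?P)" for U U'
  proof -
    have "p U' n = matrix_inv ?P ** (stokes_prod_diff S U' n ** matrix_inv ?P) ** ?P"
      using inv by (simp add: p_def flip: matrix_mul_assoc)
    then show ?thesis using form_conj[OF \<beta>, of "matrix_inv ?P" ?P] inv by simp
  qed
  have step: "p U (Suc n) = matrix_inv ?P ** U (Suc n) ** ?P + p U n" if "U \<in> stokes_tangent k" for U
    unfolding p_def by (rule log_derivative_step[OF S that Suc.prems])
  have "\<beta> (p V (Suc n)) (p W n) - \<beta> (p W (Suc n)) (p V n)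
     = \<beta> (V (Suc n)) (stokes_prod_diff S W n ** matrix_inv ?P)
       - \<beta> (W (Suc n)) (stokes_prod_diff S V n ** matrix_inv ?P)"
    by (simp add: step V W form_linear[OF \<beta>] * form_sym[OF \<beta>, of "p W n"])
  also have "\<dots> = pairing \<beta> * ((-1) ^ n * (entries V (Suc n) * log_deriv_entry (entries S) (entries W) (Suc n)
       - entries W (Suc n) * log_deriv_entry (entries S) (entries V) (Suc n)))"
    by (simp only: pairing_stokes_increment[OF \<beta> S V W Suc.prems]
        pairing_stokes_increment[OF \<beta> S W V Suc.prems] right_diff_distrib)
  finally show ?case using Suc by (simp add: distrib_left)
qed simp

text \<open>The form does not depend on the components in the direction of \<open>C\<close>, which is why it descends. The
  pullbacks of the Maurer--Cartan forms are \<open>\<gamma>\<^sub>i = C\<^sup>-\<^sup>1 (p\<^sub>i + G) C\<close> with \<open>G = dC C\<^sup>-\<^sup>1\<close>. Hence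
  \<open>(\<gamma>\<^sub>i, \<gamma>\<^sub>i\<^sub>-\<^sub>1) = (p\<^sub>i, p\<^sub>i\<^sub>-\<^sub>1) + (p\<^sub>i, G) - (p\<^sub>i\<^sub>-\<^sub>1, G)\<close>, whose sum telescopes to leave
  \<open>(p\<^sub>2\<^sub>k, G)\<close>, and this cancels against the term with \<open>\<eta>\<close>.\<close>

lemma omega_A_level_set:
  assumes \<beta>: "invariant_form \<beta>" and level: "(C, S, h) \<in> level_set k"
    and t1: "(X, V, Y) \<in> level_tangent k (C, S, h)" and t2: "(X', V', Y') \<in> level_tangent k (C, S, h)"
  shows "omega_A k \<beta> (C, S, h) (X, V, Y) (X', V', Y')
    = - (1/2) * (pairing \<beta> * fusion_sum (entries S) (entries V) (entries V') (2*k))"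
proof -
  let ?p = "(C, S, h)" and ?v = "(X, V, Y)" and ?w = "(X', V', Y')"
  define P where "P = stokes_prod S (2*k)"
  define D :: "apoint \<Rightarrow> mat2" where "D = (\<lambda>(X, V, Y). stokes_prod_diff S V (2*k))"
  define G :: "apoint \<Rightarrow> mat2" where "G = (\<lambda>(X, V, Y). X ** matrix_inv C)"
  define p :: "nat \<Rightarrow> apoint \<Rightarrow> mat2" where "p
      = (\<lambda>i (X, V, Y). matrix_inv (stokes_prod S i) ** stokes_prod_diff S V i)"
  have C: "invertible C" and S: "S \<in> stokes k" and hP: "h ** P = mat 1"
    using level by (auto simp: level_set_iff Bspace_def P_def)
  note Ci = matrix_inv_mult[OF C]
  have Ph: "P ** h = mat 1" using hP matrix_left_right_inverse by blast
  have hi: "matrix_inv h = P" and Pi: "matrix_inv P = h"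
    using hP Ph matrix_inv_eqI by blast+
  have V: "V \<in> stokes_tangent k" "V' \<in> stokes_tangent k"
    using t1 t2 by (auto simp: level_tangent_def A_tangent_def)
  \<comment> \<open>needed for \<open>C\<^sub>i\<^sup>-\<^sup>1 = C\<^sup>-\<^sup>1 P\<^sub>i\<^sup>-\<^sup>1\<close>\<close>
  have inv_mult: "matrix_inv (A ** B) = matrix_inv B ** matrix_inv A"
    if "invertible A" "invertible B" for A B :: mat2
  proof (rule matrix_inv_eqI)
    have "A ** B ** (matrix_inv B ** matrix_inv A) = A ** (B ** matrix_inv B) ** matrix_inv A"
      by (simp add: matrix_mul_assoc)
    then show "A ** B ** (matrix_inv B ** matrix_inv A) = mat 1"
      using that by (simp add: matrix_inv_mult)
  qed
  have left: "mc_left (C_map i) ?p u = matrix_inv C ** (p i u + G u) ** C" if "i \<le> 2*k" for i u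
  proof -
    have Pinv: "invertible (stokes_prod S i)" by (rule stokes_prod_invertible[OF S that])
    obtain X V Y where u: "u = (X, V, Y)" by (cases u)
    have "mc_left (C_map i) ?p u = matrix_inv C ** matrix_inv (stokes_prod S i)
        ** (stokes_prod_diff S V i ** C + stokes_prod S i ** X)"
      by (simp add: mc_left_def u A_diff_C_map, simp add: C_map_def inv_mult[OF Pinv C])
    also have "\<dots> = matrix_inv C ** (p i u ** C + (matrix_inv (stokes_prod S i) ** stokes_prod S i) ** X)"
      by (simp add: p_def u matrix_add_ldistrib matrix_mul_assoc)
    also have "\<dots> = matrix_inv C ** (p i u + G u) ** C"
      using matrix_inv_mult[OF Pinv] Ci
      by (simp add: G_def u flip: matrix_mul_assoc)
        (simp add: mat2_add_rdistrib Ci flip: matrix_mul_assoc)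
    finally show ?thesis .
  qed
  have right0: "mc_right (C_map 0) ?p u = G u" for u
    by (cases u) (simp add: mc_right_def A_diff_C_map, simp add: C_map_def G_def)
  have b1: "b_map k ?p = mat 1" using hP by (simp add: b_map_def P_def)
  have i1: "matrix_inv (mat 1 :: mat2) = mat 1" by (rule matrix_inv_eqI) simp
  have db0: "Y ** P + h ** D (X, V, Y) = 0" if "(X, V, Y) \<in> level_tangent k ?p" for X V Y
    using level_tangent_b[OF level that] by (simp add: P_def D_def)
  have rightb: "mc_right (b_map k) ?p u = 0" if "u \<in> level_tangent k ?p" for u
    using db0 that by (cases u) (simp add: mc_right_def A_diff_eqI[OF curve_deriv_b_map] P_def D_def)
  have hleft: "mc_left h_map ?p u = - (D u ** h)" if "u \<in> level_tangent k ?p" for u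
  proof -
    obtain X V Y where u: "u = (X, V, Y)" by (cases u)
    have "A_diff h_map ?p u = Y"
      by (rule A_diff_eqI) (simp add: u h_map_def A_line_def curve_deriv_line)
    moreover have "h ** D u ** h = - Y"
    proof -
      have "h ** D u = - (Y ** P)" using db0[of X V Y] that by (simp add: u eq_neg_iff_add_eq_0 add.commute)
      then have "h ** D u ** h = - (Y ** P) ** h" by simp
      also have "\<dots> = - (Y ** (P ** h))" by (simp add: mat2_eq_iff mat2_mult_nth algebra_simps)
      finally show ?thesis by (simp add: Ph)
    qed
    moreover have "P ** (h ** D u ** h) = D u ** h" using Ph by (simp add: matrix_mul_assoc)
    moreover have "P ** (- Y) = - (P ** Y)" by (simp add: mat2_eq_iff mat2_mult_nth)
    ultimately have "A_diff h_map ?p u = Y" "P ** Y = - (D u ** h)"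
      by (simp_all add: minus_equation_iff[of "P ** Y"] eq_commute)
    then show ?thesis by (simp add: mc_left_def hi) (simp add: h_map_def hi)
  qed
  have rightk: "mc_right (C_map (2*k)) ?p u = D u ** h + P ** G u ** h" for u
  proof -
    obtain X V Y where u: "u = (X, V, Y)" by (cases u)
    have "mc_right (C_map (2*k)) ?p u = (D u ** C + P ** X) ** (matrix_inv C ** h)"
      using inv_mult[of P C] C stokes_prod_invertible[OF S, of "2*k"] Pi
      by (simp add: mc_right_def u A_diff_C_map) (simp add: C_map_def D_def P_def)
    also have "\<dots> = D u ** (C ** matrix_inv C) ** h + P ** (X ** matrix_inv C) ** h"
      by (simp add: mat2_add_rdistrib matrix_mul_assoc)
    finally show ?thesis by (simp add: Ci G_def u)
  qed
  note lin = form_linear[OF \<beta>] form_minus[OF \<beta>] form_zero[OF \<beta>]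
  have conj: "\<beta> (matrix_inv C ** M ** C) (matrix_inv C ** N ** C) = \<beta> M N" for M N
    using form_conj[OF \<beta>] Ci by blast
  define w where "w M N = \<beta> (M ?v) (N ?w) - \<beta> (M ?w) (N ?v)" for M N
  have w_wedge: "wedge_pair \<beta> M N ?v ?w = w M N" for M N by (simp add: wedge_pair_def w_def)
  have w_self: "w M M = 0" and w_swap: "w M N = - w N M" for M N
    by (simp_all add: w_def form_sym[OF \<beta>])
  have term1: "wedge_pair \<beta> (mc_right (C_map 0) ?p)
      (\<lambda>u. b_map k ?p ** mc_right (C_map 0) ?p u ** matrix_inv (b_map k ?p)) ?v ?w = 0"
    unfolding wedge_pair_def right0 b1 i1 by (simp add: form_sym[OF \<beta>])
  have term2: "wedge_pair \<beta> (mc_right (C_map 0) ?p) (mc_right (b_map k) ?p) ?v ?w = 0"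
    by (simp add: wedge_pair_def rightb t1 t2 lin)
  \<comment> \<open>the contributions \<open>(dP P\<^sup>-\<^sup>1, dP P\<^sup>-\<^sup>1)\<close> cancel by symmetry\<close>
  have term3: "wedge_pair \<beta> (mc_right (C_map (2*k)) ?p) (mc_left h_map ?p) ?v ?w = - w G (p (2*k))"
  proof -
    have p2k: "D u ** h = P ** p (2*k) u ** h" for u
      using Ph by (cases u) (simp add: p_def D_def Pi flip: P_def, simp add: matrix_mul_assoc)
    have "\<beta> (P ** G u ** h) (D u' ** h) = \<beta> (G u) (p (2*k) u')" for u u'
      unfolding p2k by (rule form_conj[OF \<beta> Ph])
    then show ?thesis
      by (simp add: wedge_pair_def rightk hleft t1 t2 lin w_def form_sym[OF \<beta>, of "D ?w ** h" "D ?v ** h"])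
  qed
  have term4: "wedge_pair \<beta> (mc_left (C_map i) ?p) (mc_left (C_map (i - 1)) ?p) ?v ?w
      = w (p i) (p (i - 1)) + (w (p i) G - w (p (i - 1)) G)" if "i \<in> {1..2*k}" for i
  proof -
    have "i \<le> 2*k" "i - 1 \<le> 2*k" using that by auto
    then show ?thesis
      by (simp only: wedge_pair_def left conj w_def)
        (simp add: lin form_sym[OF \<beta>, of "G ?v" "p j u" for j u]
          form_sym[OF \<beta>, of "G ?w" "p j u" for j u] form_sym[OF \<beta>, of "G ?w" "G ?v"])
  qed
  have "(\<Sum>i = 1..2*k. w (p i) G - w (p (i - 1)) G) = w (p (2*k)) G - w (p 0) G"
    using sum_telescope''[of 0 "2*k" "\<lambda>i. w (p i) G"]
        by (simp add: sum.atLeast_Suc_atMost_Suc_shift atLeast0AtMost)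
  moreover have "w (p 0) G = 0" by (simp add: w_def p_def lin)
  moreover have "(\<Sum>i = 1..2*k. w (p i) (p (i - 1)))
      = pairing \<beta> * fusion_sum (entries S) (entries V) (entries V') (2*k)"
    using fusion_sum_pairing[OF \<beta> S V order_refl] by (simp add: w_def p_def)
  ultimately have "(\<Sum>i = 1..2*k. wedge_pair \<beta> (mc_left (C_map i) ?p) (mc_left (C_map (i - 1)) ?p) ?v ?w)
      = pairing \<beta> * fusion_sum (entries S) (entries V) (entries V') (2*k) + w (p (2*k)) G"
    by (simp only: sum.cong[OF refl term4] sum.distrib) simp
  then show ?thesis
    unfolding omega_A_def term1 term2 term3 using w_swap[of G "p (2*k)"] by simp
qed

text \<open>At the last index \<open>g\<close> and \<open>dg\<close> vanish on the level set. Therefore the last summand is zero, and for the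
  others the remainder term of \<open>fusion_sum_eq\<close> is zero.\<close>

lemma fusion_sum_Bspace:
  assumes "(S, h) \<in> Bspace k" "k \<ge> 1" "ddenom (entries S) v (2*k) = 0" "ddenom (entries S) w (2*k) = 0"
  shows "fusion_sum (entries S) v w (2*k) = - 2 * alt_hess (entries S) v w (2*k) / numer (entries S) (2*k)"
proof -
  obtain m where m: "2*k = Suc m" using assms(2) by (cases "2*k") auto
  have e: "numer (entries S) (Suc m) \<noteq> 0" and d: "denom (entries S) (Suc m) = 0"
    using assms(1) by (simp_all add: Bspace_iff m del: cont_rec.simps)
  have "fusion_sum (entries S) v w (Suc m) = fusion_sum (entries S) v w m"
    using assms(3,4) d by (simp add: m log_deriv_entry_def del: cont_rec.simps cont_rec_diff.simps)
  moreover have "fusion_rest (entries S) v w m = 0"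
    using assms(3,4) d by (simp add: m fusion_rest_def del: cont_rec.simps cont_rec_diff.simps)
  ultimately show ?thesis
    using fusion_sum_eq[of "entries S" m v w] e unfolding m
    by (simp add: field_simps del: cont_rec.simps fusion_sum.simps alt_hess.simps)
qed

text \<open>It remains to see that tangent vectors of the level set satisfy \<open>dg\<^sub>2\<^sub>k = 0\<close>: this is the
  off-diagonal entry of \<open>d(hP) = 0\<close>.\<close>

lemma reduced_form_euler:
  assumes \<beta>: "invariant_form \<beta>" and k: "k \<ge> 1"
  shows "is_reduced_form k \<beta>
    (\<lambda>p v w. euler_form k (pairing \<beta>) (B_param k p) (B_param k v) (B_param k w))"
  unfolding is_reduced_form_def
proof (intro ballI)
  fix p v w assume p: "p \<in> level_set k" and v: "v \<in> level_tangent k p" and w: "w \<in> level_tangent k p"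
  obtain C S h X V Y X' V' Y' where eqs: "p = (C, S, h)" "v = (X, V, Y)" "w = (X', V', Y')"
    by (metis prod_cases3)
  note p = p[unfolded eqs] and v = v[unfolded eqs] and w = w[unfolded eqs]
  have B: "(S, h) \<in> Bspace k" and S: "S \<in> stokes k" using p by (auto simp: level_set_iff Bspace_def)
  have dd: "ddenom (entries S) (entries V) (2*k) = 0"
    if t: "(X, V, Y) \<in> level_tangent k (C, S, h)" for X V Y
  proof -
    have V: "V \<in> stokes_tangent k" and Y: "Y $ 1 $ 2 = 0" using t
        by (auto simp: level_tangent_def A_tangent_def)
    have h: "h $ 1 $ 2 = 0" "h $ 1 $ 1 \<noteq> 0" and d: "denom (entries S) (2*k) = 0"
      using B by (auto simp: Bspace_iff simp del: cont_rec.simps)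
    have "(Y ** stokes_prod S (2*k) + h ** stokes_prod_diff S V (2*k)) $ 1 $ 2 = 0"
      using level_tangent_b[OF p t] by simp
    then show ?thesis
      using h Y d
      by (simp add: mat2_mult_nth stokes_prod_eq[OF S] stokes_prod_diff_eq[OF S V] continuant_matrix_def
          del: cont_rec.simps cont_rec_diff.simps)
  qed
  have "numer (stokes_param k S) (2*k) = numer (entries S) (2*k)" by (rule numer_stokes_param) simp
  moreover have "alt_hess (stokes_param k S) (stokes_param k V) (stokes_param k V') (2*k)
      = alt_hess (entries S) (entries V) (entries V') (2*k)"
    by (rule alt_hess_cong) (simp_all add: stokes_param_eq)
  ultimately show "euler_form k (pairing \<beta>) (B_param k (snd p)) (B_param k (snd v)) (B_param k (snd w))
      = omega_A k \<beta> p v w"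
    unfolding eqs omega_A_level_set[OF \<beta> p v w] fusion_sum_Bspace[OF B k dd[OF v] dd[OF w]]
    by (simp add: euler_form_def B_param_def)
qed

lemma quasi_hamiltonian_iso_euler:
  assumes k: "k \<ge> 1"
  shows "quasi_hamiltonian_iso k (\<lambda>p v w. \<omega> (B_param k p) (B_param k v) (B_param k w)) \<omega>"
  unfolding quasi_hamiltonian_iso_def
proof (intro conjI ballI)
  show "variety_iso (B_param k) (B_variety k) (euler_open_variety k)" by (rule variety_iso_B_param[OF k])
  show "torus_act t p \<in> Bspace k" if "t \<in> torus" "p \<in> Bspace k" for t p
    by (rule torus_act_Bspace[OF that])
  show "B_param k (torus_act t p) = scale_act (torus_char t) (B_param k p)" if "t \<in> torus" for t p
    by (cases p) (simp add: B_param_def torus_act_def stokes_param_torus_conj[OF that])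
  show "moment_B p = diag2 (euler k (B_param k p)) (inverse (euler k (B_param k p)))" if "p \<in> Bspace k" for p
  proof -
    obtain S h where p: "p = (S, h)" by (cases p)
    have e: "numer (entries S) (2*k) \<noteq> 0" and h: "h
        = diag2 (inverse (numer (entries S) (2*k))) (numer (entries S) (2*k))"
      using that by (simp_all add: p Bspace_iff del: cont_rec.simps)
    have "matrix_inv h = diag2 (numer (entries S) (2*k)) (inverse (numer (entries S) (2*k)))"
      by (rule matrix_inv_eqI) (use e in \<open>simp add: h mat2_eq_iff mat2_mult_nth mat2_one_nth\<close>)
    then show ?thesis
      by (simp add: p moment_B_def B_param_def euler_eq_cont_rec[OF k] numer_stokes_param)
  qed
qed simp

theorem proposition16:
  fixes \<beta> :: "mat2 \<Rightarrow> mat2 \<Rightarrow> complex"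
  assumes "invariant_form \<beta>"
  shows "\<exists>\<kappa>. \<kappa> \<noteq> 0 \<and> (\<forall>k\<ge>1.
    (\<exists>\<omega>B \<omega>U.
       is_reduced_form k \<beta> \<omega>B \<and>
       quasi_hamiltonian_iso k \<omega>B \<omega>U \<and>
       group_valued_moment_map k (euler_open k) scale_act \<omega>U \<kappa> (euler k)) \<and>
    (\<forall>q. q \<noteq> 0 \<longrightarrow>
       variety_iso (stokes_param k)
         (stokes_fibre k (diag2 (inverse q) q)) (euler_hypersurface k (1 / q)) \<and>
       variety_iso (fibre_quotient_map k q)
         (wild_character_variety k (diag2 (inverse q) q)) (euler_quotient k (1 / q))))"
proof (intro exI[of _ "- pairing \<beta>"] conjI allI impI)
  show "- pairing \<beta> \<noteq> 0" using pairing_nonzero[OF assms] by simp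
  fix k :: nat assume k: "1 \<le> k"
  show "\<exists>\<omega>B \<omega>U. is_reduced_form k \<beta> \<omega>B \<and> quasi_hamiltonian_iso k \<omega>B \<omega>U \<and>
      group_valued_moment_map k (euler_open k) scale_act \<omega>U (- pairing \<beta>) (euler k)"
    using reduced_form_euler[OF assms k] quasi_hamiltonian_iso_euler[OF k]
      moment_map_euler[OF k pairing_nonzero[OF assms]] by blast
  fix q :: complex assume q: "q \<noteq> 0"
  show "variety_iso (stokes_param k) (stokes_fibre k (diag2 (inverse q) q)) (euler_hypersurface k (1 / q))"
    by (rule variety_iso_stokes_fibre[OF k q])
  show "variety_iso (fibre_quotient_map k q)
      (wild_character_variety k (diag2 (inverse q) q)) (euler_quotient k (1 / q))"
    by (rule wild_character_variety_iso[OF k q])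
qed

end
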